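(* Let $G$ be a Lie group with Lie algebra $\mathfrak g$, $g$ a bi-invariant Riemannian metric on $G$ with induced inner product $\langle\cdot,\cdot\rangle$ on $\mathfrak g=T_eG$, and $\tilde X$ a left invariant vector field on $G$ with $g(\tilde X,\tilde X)<1$; put $X=\tilde X_e\in\mathfrak g$. Let $F=\frac{(\alpha+\beta)^2}{\alpha}$ be the Finsler metric on $G$ arising from $g$ and $\tilde X$, i.e. $\alpha(x,y)=\sqrt{g_x(y,y)}$, $\beta(x,y)=g_x(\tilde X(x),y)$, and suppose that the Chern connection of $F$ coincides with the Levi-Civita connection of $g$. Let $P=\mathrm{span}\{Y,U\}\subset\mathfrak g$, where $\{Y,U\}$ is an orthonormal basis of $P$ with respect to $g$. Then the flag curvature of the flag $(P,Y)$ is $$K(P,Y)=\frac{6\langle X,[Y,[U,Y]]\rangle\,\langle X,U\rangle+\langle U,[Y,[U,Y]]\rangle\,(1-\langle X,Y\rangle^2)}{4\,(1+\langle X,Y\rangle)^4\,(2\langle X,U\rangle^2-\langle X,Y\rangle^2+1)}.$$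
   Context: Since $\|\tilde X\|_g<1$ everywhere, $F$ is a Finsler metric. "The Chern connection of $F$ coincides with the Levi-Civita connection of $g$" means that the Chern connection of $F$ is the pull-back to $TG\setminus\{0\}$ of the Levi-Civita connection $\nabla$ of $g$; in particular the curvature tensor of $F$ is the curvature tensor $R$ of $g$. Convention: $R(U,V)W=\nabla_U\nabla_VW-\nabla_V\nabla_UW-\nabla_{[U,V]}W$. Flag curvature: for a flag $(P,Y)$ at a point $x$ (a 2-plane $P\subset T_xG$ and $0\ne Y\in P$) with $P=\mathrm{span}\{Y,U\}$, $$K(P,Y)=\frac{g_Y(R(U,Y)Y,U)}{g_Y(Y,Y)\,g_Y(U,U)-g_Y(Y,U)^2},\qquad g_Y(U,V)=\frac12\frac{\partial^2}{\partial s\,\partial t}F^2(x,Y+sU+tV)\Big|_{s=t=0}.$$ *)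

theory Defs
  imports "HOL-Analysis.Analysis" "HOL-Algebra.Group"
begin

section \<open>Smooth manifolds\<close>

text \<open>All uses below are on open subsets of Euclidean spaces, so \<^const>\<open>frechet_derivative\<close> at an
  interior point is insensitive to the values outside of the set.\<close>

primrec Ck_on :: "nat \<Rightarrow> ('a::euclidean_space \<Rightarrow> 'b::real_normed_vector) \<Rightarrow> 'a set \<Rightarrow> bool" where
  "Ck_on 0 f S \<longleftrightarrow> continuous_on S f"
| "Ck_on (Suc k) f S \<longleftrightarrow>
     (\<forall>x\<in>S. f differentiable (at x)) \<and> (\<forall>v. Ck_on k (\<lambda>x. frechet_derivative f (at x) v) S)"

definition smooth_on :: "('a::euclidean_space \<Rightarrow> 'b::real_normed_vector) \<Rightarrow> 'a set \<Rightarrow> bool" where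
  "smooth_on f S \<longleftrightarrow> (\<forall>k. Ck_on k f S)"

text \<open>A chart is given by its domain and its coordinate map; the values of the coordinate map
  outside of the domain are irrelevant.\<close>

type_synonym ('g, 'e) chart = "'g set \<times> ('g \<Rightarrow> 'e)"

definition chart_image :: "('g, 'e) chart \<Rightarrow> 'e set" where
  "chart_image c = snd c ` fst c"

definition chart_inv :: "('g, 'e) chart \<Rightarrow> 'e \<Rightarrow> 'g" where
  "chart_inv c = inv_into (fst c) (snd c)"

definition smooth_atlas ::
  "('g::{t2_space, second_countable_topology}, 'e::euclidean_space) chart set \<Rightarrow> bool" where
  "smooth_atlas A \<longleftrightarrow>
     (\<forall>c\<in>A. open (fst c) \<and> open (chart_image c)
        \<and> homeomorphism (fst c) (chart_image c) (snd c) (chart_inv c)) \<and>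
     (\<Union>c\<in>A. fst c) = UNIV \<and>
     (\<forall>c\<in>A. \<forall>d\<in>A. smooth_on (snd d \<circ> chart_inv c) (snd c ` (fst c \<inter> fst d)))"

definition prod_atlas ::
  "('g, 'e) chart set \<Rightarrow> ('h, 'f) chart set \<Rightarrow> ('g \<times> 'h, 'e \<times> 'f) chart set" where
  "prod_atlas A B = {(fst c \<times> fst d, map_prod (snd c) (snd d)) | c d. c \<in> A \<and> d \<in> B}"

definition smooth_map ::
  "('g::topological_space, 'e::euclidean_space) chart set \<Rightarrow>
   ('h::topological_space, 'f::euclidean_space) chart set \<Rightarrow> ('g \<Rightarrow> 'h) \<Rightarrow> bool" where
  "smooth_map A B f \<longleftrightarrow> continuous_on UNIV f \<and>
     (\<forall>c\<in>A. \<forall>d\<in>B. smooth_on (snd d \<circ> f \<circ> chart_inv c) (snd c ` (fst c \<inter> f -` fst d)))"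

text \<open>Every point \<open>x\<close> gets a preferred chart around it. The tangent space at \<open>x\<close> is the model
  space \<open>'e\<close>: a vector \<open>v :: 'e\<close> at \<open>x\<close> stands for the tangent vector whose components
  in the preferred chart of \<open>x\<close> are \<open>v\<close>. The components of a tangent vector in some other chart are
  obtained with the derivative of the coordinate change.\<close>

definition chart_at :: "('g, 'e) chart set \<Rightarrow> 'g \<Rightarrow> ('g, 'e) chart" where
  "chart_at A x = (SOME c. c \<in> A \<and> x \<in> fst c)"

definition coord_at :: "('g, 'e) chart set \<Rightarrow> 'g \<Rightarrow> 'e" where
  "coord_at A x = snd (chart_at A x) x"

text \<open>Components in the chart \<open>c\<close> of the tangent vector \<open>v\<close> at \<open>x\<close>.\<close>

definition to_chart ::
  "('g, 'e::euclidean_space) chart set \<Rightarrow> ('g, 'e) chart \<Rightarrow> 'g \<Rightarrow> 'e \<Rightarrow> 'e" where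
  "to_chart A c x v = frechet_derivative (snd c \<circ> chart_inv (chart_at A x)) (at (coord_at A x)) v"

text \<open>The tangent vector at the point with coordinates \<open>p\<close> in the chart \<open>c\<close> that has
  components \<open>y\<close> in the chart \<open>c\<close>.\<close>

definition from_chart ::
  "('g, 'e::euclidean_space) chart set \<Rightarrow> ('g, 'e) chart \<Rightarrow> 'e \<Rightarrow> 'e \<Rightarrow> 'e" where
  "from_chart A c p y = frechet_derivative (snd (chart_at A (chart_inv c p)) \<circ> chart_inv c) (at p) y"

definition tangent_map ::
  "('g, 'e::euclidean_space) chart set \<Rightarrow> ('h, 'f::euclidean_space) chart set \<Rightarrow>
   ('g \<Rightarrow> 'h) \<Rightarrow> 'g \<Rightarrow> 'e \<Rightarrow> 'f" where
  "tangent_map A B f x v =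
     frechet_derivative (snd (chart_at B (f x)) \<circ> f \<circ> chart_inv (chart_at A x)) (at (coord_at A x)) v"

definition field_in_chart ::
  "('g, 'e::euclidean_space) chart set \<Rightarrow> ('g, 'e) chart \<Rightarrow> ('g \<Rightarrow> 'e) \<Rightarrow> 'e \<Rightarrow> 'e" where
  "field_in_chart A c V p = to_chart A c (chart_inv c p) (V (chart_inv c p))"

definition smooth_vector_field ::
  "('g, 'e::euclidean_space) chart set \<Rightarrow> ('g \<Rightarrow> 'e) \<Rightarrow> bool" where
  "smooth_vector_field A V \<longleftrightarrow> (\<forall>c\<in>A. smooth_on (field_in_chart A c V) (chart_image c))"

text \<open>Sign convention: as a derivation, \<open>[V,W] f = V (W f) - W (V f)\<close>.\<close>

definition lie_bracket ::
  "('g, 'e::euclidean_space) chart set \<Rightarrow> ('g \<Rightarrow> 'e) \<Rightarrow> ('g \<Rightarrow> 'e) \<Rightarrow> 'g \<Rightarrow> 'e" where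
  "lie_bracket A V W x =
     (let v = field_in_chart A (chart_at A x) V;
          w = field_in_chart A (chart_at A x) W;
          p = coord_at A x
      in frechet_derivative w (at p) (v p) - frechet_derivative v (at p) (w p))"


section \<open>Lie groups\<close>

definition lie_group ::
  "('g::{t2_space, second_countable_topology}, 'e::euclidean_space) chart set \<Rightarrow>
   ('g, 'm) monoid_scheme \<Rightarrow> bool" where
  "lie_group A G \<longleftrightarrow> smooth_atlas A \<and> group G \<and> carrier G = UNIV \<and>
     smooth_map (prod_atlas A A) A (\<lambda>(a, b). a \<otimes>\<^bsub>G\<^esub> b) \<and> smooth_map A A (\<lambda>a. inv\<^bsub>G\<^esub> a)"

definition left_invariant_field ::
  "('g, 'e::euclidean_space) chart set \<Rightarrow> ('g, 'm) monoid_scheme \<Rightarrow> ('g \<Rightarrow> 'e) \<Rightarrow> bool" where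
  "left_invariant_field A G V \<longleftrightarrow> smooth_vector_field A V \<and>
     (\<forall>a x. V (a \<otimes>\<^bsub>G\<^esub> x) = tangent_map A A (\<lambda>b. a \<otimes>\<^bsub>G\<^esub> b) x (V x))"

definition left_extension ::
  "('g, 'e::euclidean_space) chart set \<Rightarrow> ('g, 'm) monoid_scheme \<Rightarrow> 'e \<Rightarrow> 'g \<Rightarrow> 'e" where
  "left_extension A G v a = tangent_map A A (\<lambda>b. a \<otimes>\<^bsub>G\<^esub> b) \<one>\<^bsub>G\<^esub> v"

text \<open>The Lie algebra is the tangent space at the identity with the following bracket.\<close>

definition lie_algebra_bracket ::
  "('g, 'e::euclidean_space) chart set \<Rightarrow> ('g, 'm) monoid_scheme \<Rightarrow> 'e \<Rightarrow> 'e \<Rightarrow> 'e" where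
  "lie_algebra_bracket A G u v =
     lie_bracket A (left_extension A G u) (left_extension A G v) \<one>\<^bsub>G\<^esub>"


section \<open>Riemannian metrics and the Levi-Civita connection\<close>

definition metric_in_chart ::
  "('g, 'e::euclidean_space) chart set \<Rightarrow> ('g, 'e) chart \<Rightarrow> ('g \<Rightarrow> 'e \<Rightarrow> 'e \<Rightarrow> real) \<Rightarrow>
   'e \<Rightarrow> 'e \<Rightarrow> 'e \<Rightarrow> real" where
  "metric_in_chart A c g p u v = g (chart_inv c p) (from_chart A c p u) (from_chart A c p v)"

definition riemannian_metric ::
  "('g, 'e::euclidean_space) chart set \<Rightarrow> ('g \<Rightarrow> 'e \<Rightarrow> 'e \<Rightarrow> real) \<Rightarrow> bool" where
  "riemannian_metric A g \<longleftrightarrow>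
     (\<forall>x. bilinear (g x) \<and> (\<forall>u v. g x u v = g x v u) \<and> (\<forall>u. u \<noteq> 0 \<longrightarrow> g x u u > 0)) \<and>
     (\<forall>c\<in>A. \<forall>u v. smooth_on (\<lambda>p. metric_in_chart A c g p u v) (chart_image c))"

definition bi_invariant_metric ::
  "('g, 'e::euclidean_space) chart set \<Rightarrow> ('g, 'm) monoid_scheme \<Rightarrow>
   ('g \<Rightarrow> 'e \<Rightarrow> 'e \<Rightarrow> real) \<Rightarrow> bool" where
  "bi_invariant_metric A G g \<longleftrightarrow> riemannian_metric A g \<and>
     (\<forall>a x u v.
        g (a \<otimes>\<^bsub>G\<^esub> x) (tangent_map A A (\<lambda>b. a \<otimes>\<^bsub>G\<^esub> b) x u) (tangent_map A A (\<lambda>b. a \<otimes>\<^bsub>G\<^esub> b) x v) = g x u v \<and>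
        g (x \<otimes>\<^bsub>G\<^esub> a) (tangent_map A A (\<lambda>b. b \<otimes>\<^bsub>G\<^esub> a) x u) (tangent_map A A (\<lambda>b. b \<otimes>\<^bsub>G\<^esub> a) x v) = g x u v)"

text \<open>The Christoffel symbol of the Levi-Civita connection in the chart \<open>c\<close>, as a bilinear map
  \<open>B\<close>: \<open>\<nabla>\<^sub>u W = D W (u) + B u W\<close>. Symmetry of \<open>B\<close> is vanishing of the torsion, the last condition is
  compatibility with the metric.\<close>

definition levi_civita ::
  "('g, 'e::euclidean_space) chart set \<Rightarrow> ('g \<Rightarrow> 'e \<Rightarrow> 'e \<Rightarrow> real) \<Rightarrow> ('g, 'e) chart \<Rightarrow>
   'e \<Rightarrow> 'e \<Rightarrow> 'e \<Rightarrow> 'e" where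
  "levi_civita A g c p = (THE B. bilinear B \<and> (\<forall>u v. B u v = B v u) \<and>
     (\<forall>u v w. frechet_derivative (\<lambda>q. metric_in_chart A c g q v w) (at p) u =
        metric_in_chart A c g p (B u v) w + metric_in_chart A c g p v (B u w)))"


section \<open>Finsler metrics, the Chern connection and flag curvature\<close>

text \<open>The fundamental tensor \<open>g\<^sub>y(u,v)\<close> of a Minkowski norm \<open>N\<close> on a tangent space.\<close>

definition fundamental_tensor ::
  "('e::euclidean_space \<Rightarrow> real) \<Rightarrow> 'e \<Rightarrow> 'e \<Rightarrow> 'e \<Rightarrow> real" where
  "fundamental_tensor N y u v =
     1 / 2 * deriv (\<lambda>s. deriv (\<lambda>t. (N (y + s *\<^sub>R u + t *\<^sub>R v))\<^sup>2) 0) 0"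

definition finsler_in_chart ::
  "('g, 'e::euclidean_space) chart set \<Rightarrow> ('g, 'e) chart \<Rightarrow> ('g \<Rightarrow> 'e \<Rightarrow> real) \<Rightarrow>
   'e \<Rightarrow> 'e \<Rightarrow> real" where
  "finsler_in_chart A c F p y = F (chart_inv c p) (from_chart A c p y)"

text \<open>The connection coefficients \<open>\<Gamma>(p,y)\<close> of the Chern connection on the pull-back of the tangent
  bundle to the slit tangent bundle, in the induced coordinates \<open>(p,y)\<close> and as a bilinear map \<open>B\<close>.
  The connection forms have no vertical part; symmetry of \<open>B\<close> is vanishing of the torsion.
  The last condition is almost compatibility with the metric,
  \<open>dg\<^sub>i\<^sub>j - g\<^sub>k\<^sub>j \<omega>\<^sub>i\<^sup>k - g\<^sub>i\<^sub>k \<omega>\<^sub>j\<^sup>k = 2 C\<^sub>i\<^sub>j\<^sub>k \<delta>y\<^sup>k\<close>, evaluated on the horizontal lift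
  \<open>(u, - B u y)\<close> of \<open>u\<close>; on vertical vectors the structure equation holds automatically,
  since \<open>2 C\<close> is the vertical derivative of the fundamental tensor.\<close>

definition chern ::
  "('g, 'e::euclidean_space) chart set \<Rightarrow> ('g \<Rightarrow> 'e \<Rightarrow> real) \<Rightarrow> ('g, 'e) chart \<Rightarrow>
   'e \<Rightarrow> 'e \<Rightarrow> 'e \<Rightarrow> 'e \<Rightarrow> 'e" where
  "chern A F c p y =
     (let gF = (\<lambda>q z. fundamental_tensor (finsler_in_chart A c F q) z) in
      THE B. bilinear B \<and> (\<forall>u v. B u v = B v u) \<and>
        (\<forall>u v w.
           frechet_derivative (\<lambda>q. gF q y v w) (at p) u
           - frechet_derivative (\<lambda>z. gF p z v w) (at y) (B u y) =
           gF p y (B u v) w + gF p y v (B u w)))"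

text \<open>The pull-back of an affine connection has the same coefficients, which then do not depend
  on \<open>y\<close>.\<close>

definition chern_coincides_with_levi_civita ::
  "('g, 'e::euclidean_space) chart set \<Rightarrow> ('g \<Rightarrow> 'e \<Rightarrow> real) \<Rightarrow>
   ('g \<Rightarrow> 'e \<Rightarrow> 'e \<Rightarrow> real) \<Rightarrow> bool" where
  "chern_coincides_with_levi_civita A F g \<longleftrightarrow>
     (\<forall>c\<in>A. \<forall>p\<in>chart_image c. \<forall>y. y \<noteq> 0 \<longrightarrow> chern A F c p y = levi_civita A g c p)"

text \<open>For coefficients \<open>\<Gamma>\<close> as above, the covariant derivative of a local section \<open>W\<close> of the
  pulled-back tangent bundle along the horizontal lift of the constant coordinate field \<open>u\<close>.\<close>

definition hcov ::
  "('e::euclidean_space \<Rightarrow> 'e \<Rightarrow> 'e \<Rightarrow> 'e \<Rightarrow> 'e) \<Rightarrow> 'e \<Rightarrow> ('e \<Rightarrow> 'e \<Rightarrow> 'e) \<Rightarrow> 'e \<Rightarrow> 'e \<Rightarrow> 'e" where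
  "hcov \<Gamma> u W p y =
     frechet_derivative (\<lambda>q. W q y) (at p) u
     - frechet_derivative (\<lambda>z. W p z) (at y) (\<Gamma> p y u y) + \<Gamma> p y u (W p y)"

text \<open>The curvature \<open>R(u,v)w = \<nabla>\<^sub>u \<nabla>\<^sub>v w - \<nabla>\<^sub>v \<nabla>\<^sub>u w - \<nabla>\<^bsub>[u,v]\<^esub> w\<close> on horizontal lifts of constant
  coordinate fields, for the constant section \<open>w\<close>. The commutator of the two lifts is vertical, so
  that the third term vanishes because the connection forms have no vertical part.\<close>

definition hcurv ::
  "('e::euclidean_space \<Rightarrow> 'e \<Rightarrow> 'e \<Rightarrow> 'e \<Rightarrow> 'e) \<Rightarrow> 'e \<Rightarrow> 'e \<Rightarrow> 'e \<Rightarrow> 'e \<Rightarrow> 'e \<Rightarrow> 'e" where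
  "hcurv \<Gamma> p y u v w =
     hcov \<Gamma> u (hcov \<Gamma> v (\<lambda>_ _. w)) p y - hcov \<Gamma> v (hcov \<Gamma> u (\<lambda>_ _. w)) p y"

text \<open>The flag curvature \<open>K(P,Y)\<close> at \<open>x\<close> of the flag with plane \<open>P = span {Y, U}\<close> and flagpole \<open>Y\<close>.
  The coordinates are those of the preferred chart of \<open>x\<close>, in which tangent vectors at \<open>x\<close> are
  their own components.\<close>

definition flag_curvature ::
  "('g, 'e::euclidean_space) chart set \<Rightarrow> ('g \<Rightarrow> 'e \<Rightarrow> real) \<Rightarrow> 'g \<Rightarrow> 'e \<Rightarrow> 'e \<Rightarrow> real" where
  "flag_curvature A F x Y U =
     (let gY = fundamental_tensor (F x) Y;
          R = hcurv (chern A F (chart_at A x)) (coord_at A x) Y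
      in gY (R U Y Y) U / (gY Y Y * gY U U - (gY Y U)\<^sup>2))"

end

theory Submission
  imports Defs
begin

text \<open>Everything happens in one chart \<open>c\<close> around the identity, where the group multiplication is a smooth
map \<open>mu\<close> on an open set, the coordinate vector \<open>e\<close> of the identity is a unit for it, and
associativity holds wherever both sides are defined.

By hypothesis the Chern coefficients are the Levi-Civita coefficients of \<open>g\<close>, so the curvature
\<open>R\<close> in the flag curvature is the Riemannian one. For a bi-invariant metric it is
\<open>R(U,Y)Y = 1/4 [Y,[U,Y]]\<close> (\<open>curvature_conn\<close>). The reason is the formula \<open>\<nabla>\<^sub>V Z = 1/2 [V,Z]\<close> for left
invariant fields. In a chart the formula says that the Christoffel symbol of two left invariant
fields is \<open>-1/2 (D V(Z) + D Z(V))\<close>; this is visibly symmetric, and it is compatible with the metric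
because left invariant fields have constant inner products and \<open>ad\<close> is skew (\<open>ad_invariance\<close>).
To see that \<open>ad\<close> is skew, differentiate at \<open>e\<close> the constants
\<open>g(V,Z)\<close> once for left and once for right invariant fields, and subtract. The derivative of the
metric cancels, and the two derivatives of the fields are the two mixed second derivatives of \<open>mu\<close>,
whose difference is the bracket. That the bracket of left invariant fields is left invariant
(\<open>bracket_field\<close>), which is needed to apply \<open>\<nabla>\<close> a second time, comes from differentiating the
associative law twice. Both arguments use the symmetry of second derivatives
(\<open>second_derivative_symmetric\<close>).

It remains to evaluate the fundamental tensor of \<open>(\<alpha> + \<beta>)\<^sup>2 / \<alpha>\<close> at the unit vector \<open>Y\<close>
(\<open>fundamental_tensor_square_metric\<close>). With \<open>k = 1 + \<langle>X,Y\<rangle>\<close>, both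
\<open>g\<^sub>Y(Y,Y) g\<^sub>Y(U,U) - g\<^sub>Y(Y,U)\<^sup>2\<close> and \<open>g\<^sub>Y(R,U)\<close> contain a factor \<open>k\<^sup>2\<close>, which cancels; the terms
in \<open>\<langle>Y,R\<rangle>\<close> vanish because \<open>ad Y\<close> is skew (\<open>flag_quotient\<close>).\<close>

section \<open>Calculus of smooth maps\<close>

text \<open>The second difference of \<open>h\<close> over a small square is its side squared times a value of either mixed
partial derivative inside the square, by two applications of the mean value theorem in either
order. Continuity at the corner then identifies the two values there.\<close>

lemma mixed_partials_commute:
  fixes h :: "real \<Rightarrow> real \<Rightarrow> real"
  assumes d: "0 < \<delta>"
    and hs: "\<And>s t. \<bar>s\<bar> < \<delta> \<Longrightarrow> \<bar>t\<bar> < \<delta> \<Longrightarrow> ((\<lambda>s. h s t) has_real_derivative hs s t) (at s)"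
    and ht: "\<And>s t. \<bar>s\<bar> < \<delta> \<Longrightarrow> \<bar>t\<bar> < \<delta> \<Longrightarrow> ((\<lambda>t. h s t) has_real_derivative ht s t) (at t)"
    and hst: "\<And>s t. \<bar>s\<bar> < \<delta> \<Longrightarrow> \<bar>t\<bar> < \<delta> \<Longrightarrow> ((\<lambda>t. hs s t) has_real_derivative hst s t) (at t)"
    and hts: "\<And>s t. \<bar>s\<bar> < \<delta> \<Longrightarrow> \<bar>t\<bar> < \<delta> \<Longrightarrow> ((\<lambda>s. ht s t) has_real_derivative hts s t) (at s)"
    and c1: "isCont (\<lambda>(s, t). hst s t) (0, 0)"
    and c2: "isCont (\<lambda>(s, t). hts s t) (0, 0)"
  shows "hst 0 0 = hts 0 0"
proof -
  have close: "\<bar>hst 0 0 - hts 0 0\<bar> \<le> e" if e: "0 < e" for e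
  proof -
    obtain d1 where d1: "d1 > 0"
      "\<And>z. dist z (0, 0) < d1 \<Longrightarrow> dist ((\<lambda>(s, t). hst s t) z) (hst 0 0) < e / 2"
      using c1 e unfolding continuous_at_eps_delta by (fastforce dest: spec[of _ "e / 2"])
    obtain d2 where d2: "d2 > 0"
      "\<And>z. dist z (0, 0) < d2 \<Longrightarrow> dist ((\<lambda>(s, t). hts s t) z) (hts 0 0) < e / 2"
      using c2 e unfolding continuous_at_eps_delta by (fastforce dest: spec[of _ "e / 2"])
    define r where "r = min (\<delta> / 2) (min (d1 / 2) (d2 / 2))"
    have r: "0 < r" "r < \<delta>" "r \<le> d1 / 2" "r \<le> d2 / 2"
      using d d1(1) d2(1) by (auto simp: r_def)
    have near: "dist (s, t) (0::real, 0::real) < d1 \<and> dist (s, t) (0::real, 0::real) < d2"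
      if "0 < s" "s < r" "0 < t" "t < r" for s t
    proof -
      have "dist (s, t) (0::real, 0::real) \<le> \<bar>s\<bar> + \<bar>t\<bar>"
        using norm_Pair_le[of s t] by (simp add: dist_norm)
      then show ?thesis using that r by auto
    qed
    \<comment> \<open>the second difference, first in the direction of \<open>s\<close>, then of \<open>t\<close>\<close>
    have "\<exists>z>0. z < r \<and> (h r r - h r 0) - (h 0 r - h 0 0) = (r - 0) * (hs z r - hs z 0)"
      by (rule MVT2) (use r in \<open>auto intro!: DERIV_diff hs\<close>)
    then obtain a where a: "0 < a" "a < r"
      "(h r r - h r 0) - (h 0 r - h 0 0) = r * (hs a r - hs a 0)" by auto
    have "\<exists>z>0. z < r \<and> hs a r - hs a 0 = (r - 0) * hst a z"
      by (rule MVT2) (use r a in \<open>auto intro!: hst\<close>)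
    then obtain b where b: "0 < b" "b < r" "hs a r - hs a 0 = r * hst a b" by auto
    \<comment> \<open>the same number, first in the direction of \<open>t\<close>, then of \<open>s\<close>\<close>
    have "\<exists>z>0. z < r \<and> (h r r - h 0 r) - (h r 0 - h 0 0) = (r - 0) * (ht r z - ht 0 z)"
      by (rule MVT2) (use r in \<open>auto intro!: DERIV_diff ht\<close>)
    then obtain b' where b': "0 < b'" "b' < r"
      "(h r r - h 0 r) - (h r 0 - h 0 0) = r * (ht r b' - ht 0 b')" by auto
    have "\<exists>z>0. z < r \<and> ht r b' - ht 0 b' = (r - 0) * hts z b'"
      by (rule MVT2) (use r b' in \<open>auto intro!: hts\<close>)
    then obtain a' where a': "0 < a'" "a' < r" "ht r b' - ht 0 b' = r * hts a' b'" by auto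
    have "r * (r * hst a b) = r * (r * hts a' b')"
      using a(3) b(3) b'(3) a'(3) by (simp add: algebra_simps)
    then have "hst a b = hts a' b'" using r(1) by simp
    moreover have "\<bar>hst a b - hst 0 0\<bar> < e / 2"
      using d1(2)[of "(a, b)"] near[of a b] a b by (simp add: dist_real_def)
    moreover have "\<bar>hts a' b' - hts 0 0\<bar> < e / 2"
      using d2(2)[of "(a', b')"] near[of a' b'] a' b' by (simp add: dist_real_def)
    ultimately show ?thesis by linarith
  qed
  have "\<bar>hst 0 0 - hts 0 0\<bar> \<le> 0"
    by (rule field_le_epsilon) (use close in auto)
  then show ?thesis by simp
qed

lemma smooth_on_differentiable:
  "smooth_on f S \<Longrightarrow> x \<in> S \<Longrightarrow> f differentiable at x"
  unfolding smooth_on_def using Ck_on.simps(2) by blast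

lemma smooth_on_has_derivative:
  "smooth_on f S \<Longrightarrow> x \<in> S \<Longrightarrow> (f has_derivative frechet_derivative f (at x)) (at x)"
  using smooth_on_differentiable frechet_derivative_works by blast

lemma smooth_on_derivative:
  "smooth_on f S \<Longrightarrow> smooth_on (\<lambda>x. frechet_derivative f (at x) v) S"
  unfolding smooth_on_def using Ck_on.simps(2) by blast

lemma smooth_on_continuous_on: "smooth_on f S \<Longrightarrow> continuous_on S f"
  unfolding smooth_on_def using Ck_on.simps(1) by blast

text \<open>Restrict a component of \<open>f\<close> to the plane through \<open>x\<close> spanned by \<open>u\<close> and \<open>v\<close>; the two sides are the
mixed partial derivatives of a function of two real variables.\<close>

lemma second_derivative_symmetric:
  fixes f :: "'a::euclidean_space \<Rightarrow> 'b::euclidean_space"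
  assumes f: "smooth_on f S" and S: "open S" "x \<in> S"
  shows "frechet_derivative (\<lambda>z. frechet_derivative f (at z) v) (at x) u =
         frechet_derivative (\<lambda>z. frechet_derivative f (at z) u) (at x) v"
proof (rule euclidean_eqI)
  fix b :: 'b assume "b \<in> Basis"
  define D where "D w z = frechet_derivative f (at z) w" for w z
  define D2 where "D2 w w' z = frechet_derivative (D w) (at z) w'" for w w' z
  have smD: "smooth_on (D w) S" for w
    unfolding D_def by (rule smooth_on_derivative[OF f])
  have smD2: "smooth_on (D2 w w') S" for w w'
    unfolding D2_def by (rule smooth_on_derivative[OF smD])
  have fD: "(f has_derivative (\<lambda>w. D w z)) (at z)" if "z \<in> S" for z
    unfolding D_def using smooth_on_has_derivative[OF f that] by simp
  have DD: "(D w has_derivative (\<lambda>w'. D2 w w' z)) (at z)" if "z \<in> S" for w z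
    unfolding D2_def using smooth_on_has_derivative[OF smD that] by simp
  obtain e where e: "e > 0" "ball x e \<subseteq> S" using S openE by blast
  \<comment> \<open>small enough for the parallelogram with sides \<open>\<delta> u\<close> and \<open>\<delta> v\<close> to stay in the ball\<close>
  define \<delta> where "\<delta> = e / (norm u + norm v + 1)"
  have npos: "norm u + norm v + 1 > 0" using norm_ge_zero[of u] norm_ge_zero[of v] by linarith
  have \<delta>: "\<delta> > 0" using e npos by (simp add: \<delta>_def)
  define p where "p s t = x + s *\<^sub>R u + t *\<^sub>R v" for s t
  have p: "p s t \<in> S" if "\<bar>s\<bar> < \<delta>" "\<bar>t\<bar> < \<delta>" for s t
  proof -
    have "norm (s *\<^sub>R u + t *\<^sub>R v) \<le> \<bar>s\<bar> * norm u + \<bar>t\<bar> * norm v"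
      by (metis norm_scaleR norm_triangle_ineq)
    also have "\<dots> \<le> \<delta> * norm u + \<delta> * norm v"
      using that by (intro add_mono mult_right_mono) auto
    also have "\<dots> < \<delta> * (norm u + norm v + 1)" using \<delta> by (simp add: algebra_simps)
    also have "\<dots> = e" using npos by (simp add: \<delta>_def)
    finally have "dist (p s t) x < e"
      by (simp add: p_def dist_norm add.assoc)
    then show ?thesis using e by (metis dist_commute mem_ball subsetD)
  qed
  have ps: "((\<lambda>s. p s t) has_derivative (\<lambda>h. h *\<^sub>R u)) (at s)" for s t
    unfolding p_def by (auto intro!: derivative_eq_intros)
  have pt: "((\<lambda>t. p s t) has_derivative (\<lambda>h. h *\<^sub>R v)) (at t)" for s t
    unfolding p_def by (auto intro!: derivative_eq_intros)
  have chain: "((\<lambda>s. F (q s) \<bullet> b) has_real_derivative F' w \<bullet> b) (at s)"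
    if "(F has_derivative F') (at (q s))" "(q has_derivative (\<lambda>h. h *\<^sub>R w)) (at s)"
    for F :: "'a \<Rightarrow> 'b" and F' q w and s :: real
  proof -
    have "((\<lambda>s. F (q s) \<bullet> b) has_derivative (\<lambda>h. F' (h *\<^sub>R w) \<bullet> b)) (at s)"
      using has_derivative_compose[OF that(2,1)] by (auto intro: derivative_intros)
    moreover have "F' (h *\<^sub>R w) = h *\<^sub>R F' w" for h
      using that(1) by (simp add: has_derivative_bounded_linear linear_simps)
    ultimately show ?thesis
      by (simp add: has_field_derivative_def mult.commute[of _ "F' w \<bullet> b"])
  qed
  have cont: "isCont (\<lambda>(s, t). D2 w w' (p s t) \<bullet> b) (0, 0)" for w w'
  proof -
    have "isCont (D2 w w') (p 0 0)"
      using smooth_on_continuous_on[OF smD2] S p[of 0 0] \<delta>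
      by (simp add: continuous_on_eq_continuous_at)
    moreover have "isCont (\<lambda>z. p (fst z) (snd z)) (0, 0)"
      unfolding p_def by (intro continuous_intros)
    ultimately have "isCont (\<lambda>z. D2 w w' (p (fst z) (snd z))) (0, 0)"
      using isCont_o2[of "(0, 0)" "\<lambda>z. p (fst z) (snd z)" "D2 w w'"] by simp
    from isCont_inner[OF this continuous_const[of _ b]] show ?thesis
      by (simp only: case_prod_unfold)
  qed
  have "D2 u v (p 0 0) \<bullet> b = D2 v u (p 0 0) \<bullet> b"
  proof (rule mixed_partials_commute[where \<delta> = \<delta> and h = "\<lambda>s t. f (p s t) \<bullet> b"
        and hs = "\<lambda>s t. D u (p s t) \<bullet> b" and ht = "\<lambda>s t. D v (p s t) \<bullet> b"
        and hst = "\<lambda>s t. D2 u v (p s t) \<bullet> b" and hts = "\<lambda>s t. D2 v u (p s t) \<bullet> b"])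
    show "0 < \<delta>" by (rule \<delta>)
  next
    fix s t assume st: "\<bar>s\<bar> < \<delta>" "\<bar>t\<bar> < \<delta>"
    show "((\<lambda>s. f (p s t) \<bullet> b) has_real_derivative D u (p s t) \<bullet> b) (at s)"
      by (rule chain[OF fD[OF p[OF st]] ps])
    show "((\<lambda>t. f (p s t) \<bullet> b) has_real_derivative D v (p s t) \<bullet> b) (at t)"
      by (rule chain[OF fD[OF p[OF st]] pt])
    show "((\<lambda>t. D u (p s t) \<bullet> b) has_real_derivative D2 u v (p s t) \<bullet> b) (at t)"
      by (rule chain[OF DD[OF p[OF st]] pt])
    show "((\<lambda>s. D v (p s t) \<bullet> b) has_real_derivative D2 v u (p s t) \<bullet> b) (at s)"
      by (rule chain[OF DD[OF p[OF st]] ps])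
  qed (rule cont)+
  then show "frechet_derivative (\<lambda>z. frechet_derivative f (at z) v) (at x) u \<bullet> b =
             frechet_derivative (\<lambda>z. frechet_derivative f (at z) u) (at x) v \<bullet> b"
    by (simp add: D2_def D_def[abs_def] p_def)
qed

text \<open>The product rule for a bilinear map that itself depends on the point. It is used for metrics,
Christoffel symbols and derivatives of vector fields evaluated on vector fields; only derivatives
of the values on constant vectors have to be known, since finite dimension reduces the claim to
the entries on a basis.\<close>

lemma has_derivative_moving_bilinear:
  fixes \<beta> :: "'a::real_normed_vector \<Rightarrow> 'b::euclidean_space \<Rightarrow> 'c::euclidean_space \<Rightarrow> 'd::real_normed_vector"
  assumes S: "open S" "p \<in> S" and bil: "\<And>q. q \<in> S \<Longrightarrow> bilinear (\<beta> q)"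
    and \<beta>: "\<And>v w. ((\<lambda>q. \<beta> q v w) has_derivative (\<lambda>u. \<beta>' u v w)) (at p)"
    and V: "(V has_derivative V') (at p)" and W: "(W has_derivative W') (at p)"
  shows "((\<lambda>q. \<beta> q (V q) (W q)) has_derivative
           (\<lambda>u. \<beta>' u (V p) (W p) + \<beta> p (V' u) (W p) + \<beta> p (V p) (W' u))) (at p)"
proof -
  define E where "E q v w = (\<Sum>i\<in>Basis. \<Sum>j\<in>Basis. ((v \<bullet> i) * (w \<bullet> j)) *\<^sub>R \<beta> q i j)" for q v w
  have ex: "b v w = (\<Sum>i\<in>Basis. \<Sum>j\<in>Basis. ((v \<bullet> i) * (w \<bullet> j)) *\<^sub>R b i j)"
    if "bilinear b" for b :: "'b \<Rightarrow> 'c \<Rightarrow> 'd" and v w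
  proof -
    have "b v w = b (\<Sum>i\<in>Basis. (v \<bullet> i) *\<^sub>R i) (\<Sum>j\<in>Basis. (w \<bullet> j) *\<^sub>R j)"
      by (simp add: euclidean_representation)
    also have "\<dots> = (\<Sum>i\<in>Basis. \<Sum>j\<in>Basis. ((v \<bullet> i) * (w \<bullet> j)) *\<^sub>R b i j)"
      by (simp add: bilinear_sum[OF that] sum.cartesian_product bilinear_lmul[OF that] bilinear_rmul[OF that] mult.commute)
    finally show ?thesis .
  qed
  \<comment> \<open>the derivative inherits bilinearity from the values, by uniqueness of derivatives\<close>
  have bil': "bilinear (\<beta>' u)" for u
  proof -
    have uniq: "f' u = g' u" if "(f has_derivative f') (at p)" "(g has_derivative g') (at p)"
      "\<And>q. q \<in> S \<Longrightarrow> f q = g q" for f g :: "'a \<Rightarrow> 'd" and f' g'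
      using has_derivative_unique[OF has_derivative_transform_within_open[OF that(1) S that(3)] that(2)]
      by metis
    show ?thesis
      unfolding bilinear_def linear_iff
    proof (intro allI conjI)
      fix x y z c
      show "\<beta>' u x (y + z) = \<beta>' u x y + \<beta>' u x z"
        by (rule uniq[OF \<beta> has_derivative_add[OF \<beta> \<beta>]]) (simp add: bilinear_radd[OF bil])
      show "\<beta>' u x (c *\<^sub>R y) = c *\<^sub>R \<beta>' u x y"
        by (rule uniq[OF \<beta> has_derivative_scaleR_right[OF \<beta>]]) (simp add: bilinear_rmul[OF bil])
    next
      fix x y z c
      show "\<beta>' u (y + z) x = \<beta>' u y x + \<beta>' u z x"
        by (rule uniq[OF \<beta> has_derivative_add[OF \<beta> \<beta>]]) (simp add: bilinear_ladd[OF bil])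
      show "\<beta>' u (c *\<^sub>R y) x = c *\<^sub>R \<beta>' u y x"
        by (rule uniq[OF \<beta> has_derivative_scaleR_right[OF \<beta>]]) (simp add: bilinear_lmul[OF bil])
    qed
  qed
  have "((\<lambda>q. E q (V q) (W q)) has_derivative
           (\<lambda>u. \<beta>' u (V p) (W p) + \<beta> p (V' u) (W p) + \<beta> p (V p) (W' u))) (at p)"
  proof -
    have term_ij: "((\<lambda>q. ((V q \<bullet> i) * (W q \<bullet> j)) *\<^sub>R \<beta> q i j) has_derivative
       (\<lambda>u. ((V p \<bullet> i) * (W p \<bullet> j)) *\<^sub>R \<beta>' u i j
          + ((V p \<bullet> i) * (W' u \<bullet> j) + (V' u \<bullet> i) * (W p \<bullet> j)) *\<^sub>R \<beta> p i j)) (at p)" for i j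
      by (rule has_derivative_scaleR[OF has_derivative_mult[OF
            has_derivative_inner_left[OF V] has_derivative_inner_left[OF W]] \<beta>])
    have "((\<lambda>q. E q (V q) (W q)) has_derivative
       (\<lambda>u. \<Sum>i\<in>Basis. \<Sum>j\<in>Basis. ((V p \<bullet> i) * (W p \<bullet> j)) *\<^sub>R \<beta>' u i j +
          ((V p \<bullet> i) * (W' u \<bullet> j) + (V' u \<bullet> i) * (W p \<bullet> j)) *\<^sub>R \<beta> p i j)) (at p)"
      unfolding E_def by (intro has_derivative_sum term_ij)
    also have "(\<lambda>u. \<Sum>i\<in>Basis. \<Sum>j\<in>Basis. ((V p \<bullet> i) * (W p \<bullet> j)) *\<^sub>R \<beta>' u i j +
          ((V p \<bullet> i) * (W' u \<bullet> j) + (V' u \<bullet> i) * (W p \<bullet> j)) *\<^sub>R \<beta> p i j) =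
       (\<lambda>u. \<beta>' u (V p) (W p) + \<beta> p (V' u) (W p) + \<beta> p (V p) (W' u))"
    proof
      fix u
      show "(\<Sum>i\<in>Basis. \<Sum>j\<in>Basis. ((V p \<bullet> i) * (W p \<bullet> j)) *\<^sub>R \<beta>' u i j +
          ((V p \<bullet> i) * (W' u \<bullet> j) + (V' u \<bullet> i) * (W p \<bullet> j)) *\<^sub>R \<beta> p i j) =
         \<beta>' u (V p) (W p) + \<beta> p (V' u) (W p) + \<beta> p (V p) (W' u)"
        unfolding ex[OF bil', of u "V p" "W p"] ex[OF bil[OF S(2)], of "V' u" "W p"]
          ex[OF bil[OF S(2)], of "V p" "W' u"]
        by (simp only: scaleR_add_left sum.distrib add.assoc add.commute add.left_commute)
    qed
    finally show ?thesis .
  qed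
  then show ?thesis
    by (rule has_derivative_transform_within_open[OF _ S]) (simp add: E_def ex[OF bil, symmetric])
qed

lemma has_derivative_moving_linear:
  fixes \<beta> :: "'a::real_normed_vector \<Rightarrow> 'b::euclidean_space \<Rightarrow> 'd::real_normed_vector"
  assumes S: "open S" "p \<in> S" and lin: "\<And>q. q \<in> S \<Longrightarrow> linear (\<beta> q)"
    and \<beta>: "\<And>v. ((\<lambda>q. \<beta> q v) has_derivative (\<lambda>u. \<beta>' u v)) (at p)"
    and V: "(V has_derivative V') (at p)"
  shows "((\<lambda>q. \<beta> q (V q)) has_derivative (\<lambda>u. \<beta>' u (V p) + \<beta> p (V' u))) (at p)"
proof -
  have bil: "bilinear (\<lambda>v (c::real). c *\<^sub>R \<beta> q v)" if "q \<in> S" for q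
    using lin[OF that]
    by (auto simp: bilinear_def linear_iff algebra_simps)
  have "((\<lambda>q. (1::real) *\<^sub>R \<beta> q (V q)) has_derivative
      (\<lambda>u. 1 *\<^sub>R \<beta>' u (V p) + 1 *\<^sub>R \<beta> p (V' u) + 0 *\<^sub>R \<beta> p (V p))) (at p)"
    by (rule has_derivative_moving_bilinear[where \<beta> = "\<lambda>q v c. c *\<^sub>R \<beta> q v"
          and \<beta>' = "\<lambda>u v c. c *\<^sub>R \<beta>' u v" and W = "\<lambda>_. 1" and W' = "\<lambda>_. 0", OF S bil])
      (auto intro!: has_derivative_scaleR_right \<beta> V)
  then show ?thesis by simp
qed

lemma smooth_on_has_derivative_fst:
  fixes k :: "'a::euclidean_space \<times> 'b::euclidean_space \<Rightarrow> 'c::real_normed_vector"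
  assumes "smooth_on k W" "(x, y) \<in> W"
  shows "((\<lambda>x. k (x, y)) has_derivative (\<lambda>u. frechet_derivative k (at (x, y)) (u, 0))) (at x)"
  by (rule has_derivative_compose[of "\<lambda>x. (x, y)", OF _ smooth_on_has_derivative[OF assms]])
    (auto intro!: derivative_eq_intros)

lemma smooth_on_has_derivative_snd:
  fixes k :: "'a::euclidean_space \<times> 'b::euclidean_space \<Rightarrow> 'c::real_normed_vector"
  assumes "smooth_on k W" "(x, y) \<in> W"
  shows "((\<lambda>y. k (x, y)) has_derivative (\<lambda>u. frechet_derivative k (at (x, y)) (0, u))) (at y)"
  by (rule has_derivative_compose[of "\<lambda>y. (x, y)", OF _ smooth_on_has_derivative[OF assms]])
    (auto intro!: derivative_eq_intros)

text \<open>Riesz representation for an inner product other than the ambient one: the coordinate functionals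
are \<open>b\<close>-products with suitable vectors.\<close>

lemma positive_definite_dual_family:
  fixes b :: "'e::euclidean_space \<Rightarrow> 'e \<Rightarrow> real"
  assumes bil: "bilinear b" and pos: "\<And>u. u \<noteq> 0 \<Longrightarrow> b u u > 0"
  obtains f where "\<And>i v. b (f i) v = v \<bullet> i"
proof -
  define \<Phi> where "\<Phi> u = (\<Sum>j\<in>Basis. b u j *\<^sub>R j)" for u
  have \<Phi>: "\<Phi> u \<bullet> v = b u v" for u v
  proof -
    have "b u v = b u (\<Sum>j\<in>Basis. (v \<bullet> j) *\<^sub>R j)" by (simp add: euclidean_representation)
    also have "\<dots> = (\<Sum>j\<in>Basis. (v \<bullet> j) * b u j)"
      using bil unfolding bilinear_def by (simp add: linear_sum linear_scale)
    also have "\<dots> = \<Phi> u \<bullet> v"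
      unfolding \<Phi>_def inner_sum_left inner_scaleR_left
      by (simp only: inner_commute[of v] mult.commute)
    finally show ?thesis by simp
  qed
  have lin: "linear \<Phi>"
    unfolding \<Phi>_def linear_iff
    by (simp add: bilinear_ladd[OF bil] bilinear_lmul[OF bil] scaleR_add_left sum.distrib scaleR_sum_right)
  have "inj \<Phi>"
    unfolding linear_injective_0[OF lin] using \<Phi> pos by (metis inner_zero_left less_irrefl)
  then have "surj \<Phi>" by (rule linear_injective_imp_surjective[OF lin]) simp
  then have "\<Phi> (inv_into UNIV \<Phi> i) = i" for i by (rule surj_f_inv_f)
  then have "b (inv_into UNIV \<Phi> i) v = v \<bullet> i" for i v using \<Phi> by (metis inner_commute)
  then show thesis by (rule that)
qed

section \<open>Invariant vector fields in a chart\<close>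

text \<open>A Lie group seen through one chart around its identity: \<open>D\<close> is the image of the chart, \<open>e\<close> the
coordinate vector of the identity, and \<open>W\<close> the set of pairs whose product stays in the chart.\<close>

locale local_lie_group =
  fixes mu :: "'e::euclidean_space \<times> 'e \<Rightarrow> 'e" and W :: "('e \<times> 'e) set"
    and D :: "'e set" and e :: 'e
  assumes open_D: "open D" and open_W: "open W" and smooth_mu: "smooth_on mu W"
    and e_in_D: "e \<in> D"
    and W_into_D: "(x, y) \<in> W \<Longrightarrow> x \<in> D \<and> y \<in> D \<and> mu (x, y) \<in> D"
    and right_unit: "x \<in> D \<Longrightarrow> (x, e) \<in> W \<and> mu (x, e) = x"
    and left_unit: "x \<in> D \<Longrightarrow> (e, x) \<in> W \<and> mu (e, x) = x"
    and assoc: "\<lbrakk>(x, y) \<in> W; (y, z) \<in> W; (x, mu (y, z)) \<in> W; (mu (x, y), z) \<in> W\<rbrakk>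
      \<Longrightarrow> mu (x, mu (y, z)) = mu (mu (x, y), z)"
begin

text \<open>The left and right invariant fields whose value at the identity is \<open>V\<close>.\<close>

definition lfield :: "'e \<Rightarrow> 'e \<Rightarrow> 'e" where
  "lfield V x = frechet_derivative mu (at (x, e)) (0, V)"

definition rfield :: "'e \<Rightarrow> 'e \<Rightarrow> 'e" where
  "rfield V y = frechet_derivative mu (at (e, y)) (V, 0)"

definition dlfield :: "'e \<Rightarrow> 'e \<Rightarrow> 'e \<Rightarrow> 'e" where
  "dlfield V x = frechet_derivative (lfield V) (at x)"

text \<open>The derivative of the field of \<open>Z\<close> along the field of \<open>V\<close> with respect to the flat connection
of the chart.\<close>

definition flat_deriv :: "'e \<Rightarrow> 'e \<Rightarrow> 'e \<Rightarrow> 'e" where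
  "flat_deriv V Z x = dlfield Z x (lfield V x)"

definition bracket :: "'e \<Rightarrow> 'e \<Rightarrow> 'e" where
  "bracket V Z = dlfield Z e V - dlfield V e Z"

lemma linear_dmu: "(x, y) \<in> W \<Longrightarrow> linear (frechet_derivative mu (at (x, y)))"
  using smooth_on_has_derivative[OF smooth_mu] has_derivative_linear by blast

lemma lfield_e: "lfield V e = V"
proof -
  have "((\<lambda>y. y) has_derivative (\<lambda>u. frechet_derivative mu (at (e, e)) (0, u))) (at e)"
    by (rule has_derivative_transform_within_open[OF smooth_on_has_derivative_snd[OF smooth_mu] open_D e_in_D])
      (use left_unit e_in_D in auto)
  from has_derivative_unique[OF this has_derivative_ident] show ?thesis
    unfolding lfield_def by meson
qed

lemma rfield_e: "rfield V e = V"
proof -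
  have "((\<lambda>y. y) has_derivative (\<lambda>u. frechet_derivative mu (at (e, e)) (u, 0))) (at e)"
    by (rule has_derivative_transform_within_open[OF smooth_on_has_derivative_fst[OF smooth_mu] open_D e_in_D])
      (use right_unit e_in_D in auto)
  from has_derivative_unique[OF this has_derivative_ident] show ?thesis
    unfolding rfield_def by meson
qed

text \<open>The derivative of a left invariant field is a mixed second derivative of the multiplication, one
differentiation in each factor.\<close>

lemma lfield_has_derivative_mixed:
  assumes "x \<in> D"
  shows "(lfield V has_derivative
    (\<lambda>u. frechet_derivative (\<lambda>z. frechet_derivative mu (at z) (0, V)) (at (x, e)) (u, 0))) (at x)"
  unfolding lfield_def
  by (rule smooth_on_has_derivative_fst[OF smooth_on_derivative[OF smooth_mu]]) (use right_unit assms in simp)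

lemma lfield_has_derivative: "x \<in> D \<Longrightarrow> (lfield V has_derivative dlfield V x) (at x)"
  unfolding dlfield_def
  using lfield_has_derivative_mixed frechet_derivative_at by metis

lemma dlfield_mixed:
  "x \<in> D \<Longrightarrow> dlfield V x u =
     frechet_derivative (\<lambda>z. frechet_derivative mu (at z) (0, V)) (at (x, e)) (u, 0)"
  unfolding dlfield_def by (subst frechet_derivative_at[OF lfield_has_derivative_mixed, symmetric]) auto

lemma linear_lfield:
  assumes "x \<in> D"
  shows "linear (\<lambda>V. lfield V x)"
proof -
  have l: "linear (frechet_derivative mu (at (x, e)))"
    using assms right_unit linear_dmu by blast
  show ?thesis
    unfolding lfield_def linear_iff
  proof (intro allI conjI)
    fix V Z c
    show "frechet_derivative mu (at (x, e)) (0, V + Z) =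
      frechet_derivative mu (at (x, e)) (0, V) + frechet_derivative mu (at (x, e)) (0, Z)"
      using linear_add[OF l, of "(0, V)" "(0, Z)"] by simp
    show "frechet_derivative mu (at (x, e)) (0, c *\<^sub>R V) = c *\<^sub>R frechet_derivative mu (at (x, e)) (0, V)"
      using linear_scale[OF l, of c "(0, V)"] by simp
  qed
qed

lemma bilinear_dlfield:
  assumes x: "x \<in> D"
  shows "bilinear (\<lambda>u V. dlfield V x u)"
  unfolding bilinear_def
proof (intro conjI allI)
  fix V show "linear (\<lambda>u. dlfield V x u)"
    using lfield_has_derivative[OF x] has_derivative_linear by blast
next
  fix u
  note uniq = has_derivative_unique[OF has_derivative_transform_within_open[OF _ open_D x]]
  show "linear (\<lambda>V. dlfield V x u)"
    unfolding linear_iff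
  proof (intro allI conjI)
    fix V Z c
    show "dlfield (V + Z) x u = dlfield V x u + dlfield Z x u"
      using uniq[OF lfield_has_derivative[OF x] _ has_derivative_add[OF lfield_has_derivative[OF x] lfield_has_derivative[OF x]], of "V + Z" V Z]
      by (simp add: linear_add[OF linear_lfield] fun_eq_iff)
    show "dlfield (c *\<^sub>R V) x u = c *\<^sub>R dlfield V x u"
      using uniq[OF lfield_has_derivative[OF x] _ has_derivative_scaleR_right[OF lfield_has_derivative[OF x]], of "c *\<^sub>R V" c V]
      by (simp add: linear_scale[OF linear_lfield] fun_eq_iff)
  qed
qed

lemma dlfield_differentiable:
  assumes "x \<in> D"
  shows "(\<lambda>q. dlfield V q u) differentiable at x"
proof -
  have "((\<lambda>q. frechet_derivative (\<lambda>z. frechet_derivative mu (at z) (0, V)) (at (q, e)) (u, 0))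
     has_derivative (\<lambda>h. frechet_derivative (\<lambda>z. frechet_derivative (\<lambda>z. frechet_derivative mu (at z) (0, V)) (at z) (u, 0))
       (at (x, e)) (h, 0))) (at x)"
    by (rule smooth_on_has_derivative_fst[OF smooth_on_derivative[OF smooth_on_derivative[OF smooth_mu]]])
      (use right_unit assms in simp)
  then have "((\<lambda>q. dlfield V q u) has_derivative (\<lambda>h. frechet_derivative (\<lambda>z. frechet_derivative (\<lambda>z. frechet_derivative mu (at z) (0, V)) (at z) (u, 0))
       (at (x, e)) (h, 0))) (at x)"
    by (rule has_derivative_transform_within_open[OF _ open_D assms]) (simp add: dlfield_mixed)
  then show ?thesis by (auto simp: differentiable_def)
qed

definition ddlfield :: "'e \<Rightarrow> 'e \<Rightarrow> 'e \<Rightarrow> 'e \<Rightarrow> 'e" where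
  "ddlfield V x h u = frechet_derivative (\<lambda>q. dlfield V q u) (at x) h"

lemma dlfield_has_derivative:
  "x \<in> D \<Longrightarrow> ((\<lambda>q. dlfield V q u) has_derivative (\<lambda>h. ddlfield V x h u)) (at x)"
  unfolding ddlfield_def using dlfield_differentiable frechet_derivative_works by fastforce

text \<open>This is where third derivatives of the multiplication enter; the symmetry cancels the second
derivatives of the fields in the curvature.\<close>

lemma ddlfield_symmetric:
  assumes x: "x \<in> D"
  shows "ddlfield V x h u = ddlfield V x u h"
proof -
  let ?k = "\<lambda>z. frechet_derivative mu (at z) (0, V)"
  have sk: "smooth_on ?k W" by (rule smooth_on_derivative[OF smooth_mu])
  have xe: "(x, e) \<in> W" using right_unit x by simp
  have "ddlfield V x h u = frechet_derivative (\<lambda>z. frechet_derivative ?k (at z) (u, 0)) (at (x, e)) (h, 0)" for h u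
  proof -
    have "((\<lambda>q. dlfield V q u) has_derivative
        (\<lambda>h. frechet_derivative (\<lambda>z. frechet_derivative ?k (at z) (u, 0)) (at (x, e)) (h, 0))) (at x)"
      by (rule has_derivative_transform_within_open[OF smooth_on_has_derivative_fst[OF smooth_on_derivative[OF sk] xe] open_D x])
        (simp add: dlfield_mixed)
    from fun_cong[OF has_derivative_unique[OF this dlfield_has_derivative[OF x]], of h] show ?thesis by simp
  qed
  then show ?thesis
    using second_derivative_symmetric[OF sk open_W xe] by simp
qed

lemma flat_deriv_has_derivative:
  assumes x: "x \<in> D"
  shows "((\<lambda>q. flat_deriv V Z q) has_derivative
     (\<lambda>h. ddlfield Z x h (lfield V x) + dlfield Z x (dlfield V x h))) (at x)"
  unfolding flat_deriv_def
proof (rule has_derivative_moving_linear[where \<beta> = "dlfield Z", OF open_D x])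
  show "linear (dlfield Z q)" if "q \<in> D" for q
    using bilinear_dlfield[OF that] by (simp add: bilinear_def)
qed (use dlfield_has_derivative lfield_has_derivative x in auto)

lemma bilinear_flat_deriv:
  assumes x: "x \<in> D"
  shows "bilinear (\<lambda>V Z. flat_deriv V Z x)"
  using bilinear_dlfield[OF x] linear_lfield[OF x]
  unfolding bilinear_def flat_deriv_def
  by (auto intro: linear_compose[unfolded o_def])

lemma flat_deriv_e: "flat_deriv V Z e = dlfield Z e V"
  by (simp add: flat_deriv_def lfield_e)

text \<open>Differentiate the associative law \<open>x (y z) = (x y) z\<close> in \<open>z\<close> at the identity.\<close>

lemma lfield_left_invariant:
  assumes xy: "(x, y) \<in> W"
  shows "lfield V (mu (x, y)) = frechet_derivative mu (at (x, y)) (0, lfield V y)"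
proof -
  have y: "y \<in> D" "(y, e) \<in> W" "mu (y, e) = y" and xy': "mu (x, y) \<in> D" "(mu (x, y), e) \<in> W"
    using W_into_D[OF xy] right_unit by auto
  have d1: "((\<lambda>z. mu (y, z)) has_derivative (\<lambda>u. frechet_derivative mu (at (y, e)) (0, u))) (at e)"
    by (rule smooth_on_has_derivative_snd[OF smooth_mu y(2)])
  have "((\<lambda>z. mu (x, z)) has_derivative (\<lambda>u. frechet_derivative mu (at (x, y)) (0, u))) (at (mu (y, e)))"
    using smooth_on_has_derivative_snd[OF smooth_mu xy] y by simp
  from has_derivative_compose[OF d1 this]
  have d2: "((\<lambda>z. mu (x, mu (y, z))) has_derivative
      (\<lambda>u. frechet_derivative mu (at (x, y)) (0, frechet_derivative mu (at (y, e)) (0, u)))) (at e)" .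
  have d3: "((\<lambda>z. mu (mu (x, y), z)) has_derivative (\<lambda>u. frechet_derivative mu (at (mu (x, y), e)) (0, u))) (at e)"
    by (rule smooth_on_has_derivative_snd[OF smooth_mu xy'(2)])
  have t: "((\<lambda>z. mu (y, z)) \<longlongrightarrow> y) (at e)"
    using has_derivative_continuous[OF d1] y by (simp add: continuous_at)
  have "\<forall>\<^sub>F z in at e. (y, z) \<in> W"
    by (rule topological_tendstoD[OF _ open_W y(2)]) (auto intro!: tendsto_intros)
  moreover have "\<forall>\<^sub>F z in at e. (mu (x, y), z) \<in> W"
    by (rule topological_tendstoD[OF _ open_W xy'(2)]) (auto intro!: tendsto_intros)
  moreover have "\<forall>\<^sub>F z in at e. (x, mu (y, z)) \<in> W"
    by (rule topological_tendstoD[OF _ open_W xy]) (auto intro!: tendsto_intros t)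
  ultimately have "\<forall>\<^sub>F z in at e. mu (x, mu (y, z)) = mu (mu (x, y), z)"
    by eventually_elim (use assoc xy in auto)
  from has_derivative_transform_eventually[OF d2 this] y right_unit xy'
  have "((\<lambda>z. mu (mu (x, y), z)) has_derivative
      (\<lambda>u. frechet_derivative mu (at (x, y)) (0, frechet_derivative mu (at (y, e)) (0, u)))) (at e)"
    by simp
  from fun_cong[OF has_derivative_unique[OF this d3], of V] show ?thesis
    unfolding lfield_def by simp
qed

text \<open>The bracket of two left invariant fields is the left invariant field of the bracket. Differentiating
\<open>lfield_left_invariant\<close> in \<open>y\<close> at the identity expresses \<open>flat_deriv V Z x\<close> as a second derivative
of left translation by \<open>x\<close>, symmetric in \<open>V\<close> and \<open>Z\<close>, plus the translate of \<open>flat_deriv V Z e\<close>.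
The symmetric part drops out of the commutator.\<close>

lemma bracket_field:
  assumes x: "x \<in> D"
  shows "flat_deriv V Z x - flat_deriv Z V x = lfield (bracket V Z) x"
proof -
  have xe: "(x, e) \<in> W" "mu (x, e) = x" using right_unit x by auto
  define N where "N = {y. (x, y) \<in> W}"
  have N: "open N" "e \<in> N"
    using xe open_vimage[OF open_W continuous_on_Pair[OF continuous_on_const continuous_on_id], of x]
    by (auto simp: N_def vimage_def)
  let ?S = "\<lambda>V Z. frechet_derivative (\<lambda>z. frechet_derivative mu (at z) (0, Z)) (at (x, e)) (0, V)"
  have key: "flat_deriv V Z x = ?S V Z + lfield (dlfield Z e V) x" for V Z
  proof -
    have "((\<lambda>y. mu (x, y)) has_derivative (\<lambda>u. lfield u x)) (at e)"
      unfolding lfield_def by (rule smooth_on_has_derivative_snd[OF smooth_mu xe(1)])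
    moreover have "(lfield Z has_derivative dlfield Z x) (at (mu (x, e)))"
      using lfield_has_derivative[OF x] xe by simp
    ultimately have d1: "((\<lambda>y. lfield Z (mu (x, y))) has_derivative (\<lambda>u. dlfield Z x (lfield u x))) (at e)"
      by (rule has_derivative_compose)
    have lin: "linear (\<lambda>v. frechet_derivative mu (at (x, y)) (0, v))" if "y \<in> N" for y
    proof -
      have l: "linear (frechet_derivative mu (at (x, y)))" using that linear_dmu N_def by blast
      show ?thesis
        using linear_compose[OF _ l, of "\<lambda>v. (0, v)"] by (simp add: o_def linear_iff)
    qed
    have "((\<lambda>y. frechet_derivative mu (at (x, y)) (0, lfield Z y)) has_derivative
       (\<lambda>u. ?S u (lfield Z e) + frechet_derivative mu (at (x, e)) (0, dlfield Z e u))) (at e)"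
      by (rule has_derivative_moving_linear[where \<beta> = "\<lambda>y v. frechet_derivative mu (at (x, y)) (0, v)", OF N lin])
       (auto intro: lfield_has_derivative e_in_D smooth_on_has_derivative_snd[OF smooth_on_derivative[OF smooth_mu] xe(1)])
    then have "((\<lambda>y. lfield Z (mu (x, y))) has_derivative
       (\<lambda>u. ?S u (lfield Z e) + frechet_derivative mu (at (x, e)) (0, dlfield Z e u))) (at e)"
      by (rule has_derivative_transform_within_open[OF _ N]) (simp add: N_def lfield_left_invariant)
    from has_derivative_unique[OF d1 this] show ?thesis
      unfolding flat_deriv_def lfield_e by (simp add: lfield_def fun_eq_iff)
  qed
  have "?S V Z = ?S Z V"
    by (rule second_derivative_symmetric[OF smooth_mu open_W xe(1)])
  then show ?thesis
    unfolding key[of V Z] key[of Z V] bracket_def by (simp add: linear_diff[OF linear_lfield[OF x]])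
qed

text \<open>Compared with the left invariant fields, the two arguments of the mixed second derivative of \<open>mu\<close>
at \<open>(e, e)\<close> are exchanged.\<close>

lemma rfield_has_derivative:
  "(rfield V has_derivative (\<lambda>u. dlfield u e V)) (at e)"
proof -
  have ee: "(e, e) \<in> W" using e_in_D right_unit by auto
  have "dlfield u e V = frechet_derivative (\<lambda>z. frechet_derivative mu (at z) (V, 0)) (at (e, e)) (0, u)" for u
    using dlfield_mixed[OF e_in_D] second_derivative_symmetric[OF smooth_mu open_W ee] by simp
  then show ?thesis
    using smooth_on_has_derivative_snd[OF smooth_on_derivative[OF smooth_mu] ee, of "(V, 0)"]
    unfolding rfield_def by simp
qed

end

section \<open>Levi-Civita connection and curvature of a bi-invariant metric\<close>

locale bi_invariant_local_lie_group = local_lie_group mu W D e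
  for mu :: "'e::euclidean_space \<times> 'e \<Rightarrow> 'e" and W D e +
  fixes gm :: "'e \<Rightarrow> 'e \<Rightarrow> 'e \<Rightarrow> real"
  assumes bilinear_gm: "x \<in> D \<Longrightarrow> bilinear (gm x)"
    and gm_sym: "x \<in> D \<Longrightarrow> gm x u v = gm x v u"
    and gm_pos: "u \<noteq> 0 \<Longrightarrow> gm e u u > 0"
    and gm_differentiable: "x \<in> D \<Longrightarrow> (\<lambda>q. gm q u v) differentiable at x"
    and gm_left: "x \<in> D \<Longrightarrow> gm x (lfield V x) (lfield Z x) = gm e V Z"
    and gm_right: "x \<in> D \<Longrightarrow> gm x (rfield V x) (rfield Z x) = gm e V Z"
begin

definition dgm :: "'e \<Rightarrow> 'e \<Rightarrow> 'e \<Rightarrow> 'e \<Rightarrow> real" where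
  "dgm x u v w = frechet_derivative (\<lambda>q. gm q v w) (at x) u"

lemma gm_has_derivative: "x \<in> D \<Longrightarrow> ((\<lambda>q. gm q v w) has_derivative (\<lambda>u. dgm x u v w)) (at x)"
  unfolding dgm_def using gm_differentiable frechet_derivative_works by fastforce

text \<open>The product rule applied to a constant inner product of two fields.\<close>

lemma dgm_invariant_fields:
  assumes x: "x \<in> D" and const: "\<And>q. q \<in> D \<Longrightarrow> gm q (V q) (Z q) = c"
    and V: "(V has_derivative V') (at x)" and Z: "(Z has_derivative Z') (at x)"
  shows "dgm x u (V x) (Z x) + gm x (V' u) (Z x) + gm x (V x) (Z' u) = 0"
proof -
  have "((\<lambda>q. gm q (V q) (Z q)) has_derivative
     (\<lambda>u. dgm x u (V x) (Z x) + gm x (V' u) (Z x) + gm x (V x) (Z' u))) (at x)"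
    by (rule has_derivative_moving_bilinear[OF open_D x bilinear_gm gm_has_derivative[OF x] V Z])
  then have "((\<lambda>q. c) has_derivative
     (\<lambda>u. dgm x u (V x) (Z x) + gm x (V' u) (Z x) + gm x (V x) (Z' u))) (at x)"
    by (rule has_derivative_transform_within_open[OF _ open_D x]) (simp add: const)
  from has_derivative_unique[OF this has_derivative_const] show ?thesis by meson
qed

text \<open>Left and right invariant fields both have constant inner products. Subtracting the two resulting
identities at \<open>e\<close> removes the derivative of the metric and leaves the difference of the derivatives
of the left and right invariant fields, which is the bracket.\<close>

lemma ad_invariance: "gm e (bracket U V) Z + gm e V (bracket U Z) = 0"
proof -
  note bil = bilinear_gm[OF e_in_D]
  have "dgm e U V Z + gm e (dlfield V e U) Z + gm e V (dlfield Z e U) = 0"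
    using dgm_invariant_fields[OF e_in_D gm_left lfield_has_derivative[OF e_in_D] lfield_has_derivative[OF e_in_D]]
    by (simp add: lfield_e)
  moreover have "dgm e U V Z + gm e (dlfield U e V) Z + gm e V (dlfield U e Z) = 0"
    using dgm_invariant_fields[OF e_in_D gm_right rfield_has_derivative rfield_has_derivative]
    by (simp add: rfield_e)
  ultimately show ?thesis
    by (simp add: bracket_def bilinear_lsub[OF bil] bilinear_rsub[OF bil])
qed

text \<open>The vector representing the coordinate functional of \<open>i\<close>. It makes the inverse of the left
invariant frame explicit, see \<open>coframe\<close>, so that this inverse is differentiable because the metric
and the frame are.\<close>

definition dual_vector :: "'e \<Rightarrow> 'e" where
  "dual_vector = (SOME f. \<forall>i v. gm e (f i) v = v \<bullet> i)"

lemma dual_vector: "gm e (dual_vector i) v = v \<bullet> i"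
proof -
  have "\<exists>f. \<forall>i v. gm e (f i) v = v \<bullet> i"
    using positive_definite_dual_family[OF bilinear_gm[OF e_in_D] gm_pos] by metis
  from someI_ex[OF this] show ?thesis by (simp add: dual_vector_def)
qed

text \<open>The left invariant Maurer-Cartan form: the element of the Lie algebra whose left invariant field
passes through \<open>v\<close> at \<open>x\<close>.\<close>

definition coframe :: "'e \<Rightarrow> 'e \<Rightarrow> 'e" where
  "coframe x v = (\<Sum>i\<in>Basis. gm x (lfield (dual_vector i) x) v *\<^sub>R i)"

lemma coframe_lfield: "x \<in> D \<Longrightarrow> coframe x (lfield V x) = V"
  by (simp add: coframe_def gm_left dual_vector euclidean_representation)

lemma lfield_coframe:
  assumes x: "x \<in> D"
  shows "lfield (coframe x v) x = v"
proof -
  have "inj (\<lambda>V. lfield V x)" using coframe_lfield[OF x] by (metis injI)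
  then have "surj (\<lambda>V. lfield V x)"
    by (rule linear_injective_imp_surjective[OF linear_lfield[OF x]]) simp
  then obtain V where "v = lfield V x" by blast
  then show ?thesis using coframe_lfield[OF x] by simp
qed

lemma linear_coframe:
  assumes x: "x \<in> D"
  shows "linear (coframe x)"
  unfolding coframe_def linear_iff
  by (simp add: bilinear_radd[OF bilinear_gm[OF x]] bilinear_rmul[OF bilinear_gm[OF x]]
      scaleR_add_left sum.distrib scaleR_sum_right)

lemma coframe_differentiable:
  assumes x: "x \<in> D"
  shows "(\<lambda>q. coframe q v) differentiable at x"
proof -
  have "(\<lambda>q. gm q (lfield V q) v) differentiable at x" for V
    using has_derivative_moving_bilinear[OF open_D x bilinear_gm gm_has_derivative[OF x]
        lfield_has_derivative[OF x] has_derivative_const]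
    unfolding differentiable_def by blast
  then show ?thesis
    unfolding coframe_def by (auto intro!: differentiable_sum differentiable_scaleR)
qed

text \<open>The Christoffel symbol, in the chart, of the connection with \<open>\<nabla>\<^sub>V Z = 1/2 [V,Z]\<close> on left invariant
fields: from \<open>\<nabla>\<^sub>V Z = D Z(V) + B V Z\<close> and \<open>[V,Z] = D Z(V) - D V(Z)\<close> one gets
\<open>B V Z = -1/2 (D Z(V) + D V(Z))\<close>.\<close>

definition conn :: "'e \<Rightarrow> 'e \<Rightarrow> 'e \<Rightarrow> 'e" where
  "conn x v w = - (1 / 2) *\<^sub>R (flat_deriv (coframe x v) (coframe x w) x + flat_deriv (coframe x w) (coframe x v) x)"

lemma conn_lfield:
  "x \<in> D \<Longrightarrow> conn x (lfield V x) (lfield Z x) = - (1 / 2) *\<^sub>R (flat_deriv V Z x + flat_deriv Z V x)"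
  by (simp add: conn_def coframe_lfield)

lemma conn_sym: "conn x v w = conn x w v"
  by (simp add: conn_def add.commute)

lemma bilinear_conn:
  assumes x: "x \<in> D"
  shows "bilinear (conn x)"
  unfolding bilinear_def conn_def linear_iff
  by (simp add: linear_add[OF linear_coframe[OF x]] linear_scale[OF linear_coframe[OF x]]
      bilinear_radd[OF bilinear_flat_deriv[OF x]] bilinear_rmul[OF bilinear_flat_deriv[OF x]]
      bilinear_ladd[OF bilinear_flat_deriv[OF x]] bilinear_lmul[OF bilinear_flat_deriv[OF x]] algebra_simps)

text \<open>Along left invariant fields \<open>V\<close>, \<open>Z\<close> the inner product is constant, so compatibility amounts to
\<open>g(\<nabla>\<^sub>U V, Z) + g(V, \<nabla>\<^sub>U Z) = 0\<close>, which is skewness of \<open>ad U\<close>.\<close>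

lemma conn_metric:
  assumes x: "x \<in> D"
  shows "dgm x u v w = gm x (conn x u v) w + gm x v (conn x u w)"
proof -
  note bil = bilinear_gm[OF x]
  define U V Z where "U = coframe x u" and "V = coframe x v" and "Z = coframe x w"
  have uvw: "u = lfield U x" "v = lfield V x" "w = lfield Z x"
    by (simp_all add: U_def V_def Z_def lfield_coframe[OF x])
  have c: "conn x u (lfield V x) = (1 / 2) *\<^sub>R lfield (bracket U V) x - flat_deriv U V x" for V
    unfolding uvw(1) conn_lfield[OF x] bracket_field[OF x, symmetric]
    by (simp add: algebra_simps flip: scaleR_left.add)
  have "dgm x u v w + gm x (flat_deriv U V x) w + gm x v (flat_deriv U Z x) = 0"
    using dgm_invariant_fields[OF x gm_left[of _ V Z] lfield_has_derivative[OF x]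
        lfield_has_derivative[OF x], where u = u]
    by (simp add: uvw flat_deriv_def)
  moreover have "gm x (lfield (bracket U V) x) w + gm x v (lfield (bracket U Z) x) = 0"
    using ad_invariance[of U V Z] by (simp add: uvw gm_left[OF x])
  ultimately show ?thesis
    by (simp add: uvw(2,3) c bilinear_lsub[OF bil] bilinear_rsub[OF bil] bilinear_lmul[OF bil]
        bilinear_rmul[OF bil])
qed

lemma gm_nondegenerate:
  assumes x: "x \<in> D" and 0: "\<And>w. gm x v w = 0"
  shows "v = 0"
proof -
  have "gm e (coframe x v) (coframe x v) = 0"
    using 0[of v] gm_left[OF x, of "coframe x v" "coframe x v"] by (simp add: lfield_coframe[OF x])
  then have "coframe x v = 0" using gm_pos by (metis less_irrefl)
  then show ?thesis using lfield_coframe[OF x, of v] linear_0[OF linear_lfield[OF x]] by simp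
qed

text \<open>The difference of two torsion free metric connections gives a trilinear form that is symmetric in
the first two and skew in the last two arguments; such a form vanishes.\<close>

lemma conn_unique:
  assumes x: "x \<in> D" and B: "bilinear B" and sym: "\<And>u v. B u v = B v u"
    and met: "\<And>u v w. dgm x u v w = gm x (B u v) w + gm x v (B u w)"
  shows "B = conn x"
proof (intro ext)
  fix u v
  note bil = bilinear_gm[OF x]
  define T where "T u v w = gm x (B u v - conn x u v) w" for u v w
  have T1: "T u v w = T v u w" for u v w
    by (simp add: T_def sym[of u v] conn_sym[of x u v])
  have T2: "T u v w = - T u w v" for u v w
    using met[of u v w] conn_metric[OF x, of u v w]
    by (simp add: T_def bilinear_lsub[OF bil] bilinear_rsub[OF bil] gm_sym[OF x, of _ v] algebra_simps)
  have "T u v w = 0" for u v w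
    using T1[of u v w] T1[of v w u] T1[of u w v] T2[of u v w] T2[of v u w] T2[of w u v]
    by linarith
  then have "B u v - conn x u v = 0"
    unfolding T_def by (rule gm_nondegenerate[OF x])
  then show "B u v = conn x u v" by simp
qed

lemma levi_civita_conn:
  assumes x: "x \<in> D"
  shows "(THE B. bilinear B \<and> (\<forall>u v. B u v = B v u) \<and>
     (\<forall>u v w. frechet_derivative (\<lambda>q. gm q v w) (at x) u = gm x (B u v) w + gm x v (B u w))) = conn x"
proof (rule the_equality)
  show "bilinear (conn x) \<and> (\<forall>u v. conn x u v = conn x v u) \<and>
     (\<forall>u v w. frechet_derivative (\<lambda>q. gm q v w) (at x) u = gm x (conn x u v) w + gm x v (conn x u w))"
    using bilinear_conn[OF x] conn_sym[of x] conn_metric[OF x, unfolded dgm_def] by blast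
next
  fix B assume B: "bilinear B \<and> (\<forall>u v. B u v = B v u) \<and>
     (\<forall>u v w. frechet_derivative (\<lambda>q. gm q v w) (at x) u = gm x (B u v) w + gm x v (B u w))"
  show "B = conn x"
    by (rule conn_unique[OF x]) (use B in \<open>unfold dgm_def, blast+\<close>)
qed

definition dconn :: "'e \<Rightarrow> 'e \<Rightarrow> 'e \<Rightarrow> 'e" where
  "dconn h v w = frechet_derivative (\<lambda>q. conn q v w) (at e) h"

lemma conn_has_derivative:
  "((\<lambda>q. conn q v w) has_derivative (\<lambda>h. dconn h v w)) (at e)"
proof -
  have d: "(\<lambda>q. flat_deriv (coframe q v) (coframe q w) q) differentiable at e" for v w
    using has_derivative_moving_bilinear[OF open_D e_in_D bilinear_flat_deriv flat_deriv_has_derivative[OF e_in_D]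
        coframe_differentiable[OF e_in_D, of v, unfolded frechet_derivative_works]
        coframe_differentiable[OF e_in_D, of w, unfolded frechet_derivative_works]]
    unfolding differentiable_def by blast
  have "(\<lambda>q. conn q v w) differentiable at e"
    unfolding conn_def by (intro differentiable_scaleR differentiable_add differentiable_const d)
  then show ?thesis
    unfolding dconn_def using frechet_derivative_works by fastforce
qed

text \<open>Differentiates \<open>conn_lfield\<close>; this gives the derivative of the Christoffel symbol on constant
vectors, as needed in the chart formula for the curvature.\<close>

lemma dconn_lfields:
  "dconn h V Z + conn e (dlfield V e h) Z + conn e V (dlfield Z e h) =
    - (1 / 2) *\<^sub>R (ddlfield Z e h V + dlfield Z e (dlfield V e h) + (ddlfield V e h Z + dlfield V e (dlfield Z e h)))"
proof -
  have "((\<lambda>q. conn q (lfield V q) (lfield Z q)) has_derivative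
     (\<lambda>h. dconn h (lfield V e) (lfield Z e) + conn e (dlfield V e h) (lfield Z e) + conn e (lfield V e) (dlfield Z e h))) (at e)"
    by (rule has_derivative_moving_bilinear[OF open_D e_in_D bilinear_conn conn_has_derivative
        lfield_has_derivative[OF e_in_D] lfield_has_derivative[OF e_in_D]])
  then have "((\<lambda>q. - (1 / 2) *\<^sub>R (flat_deriv V Z q + flat_deriv Z V q)) has_derivative
     (\<lambda>h. dconn h (lfield V e) (lfield Z e) + conn e (dlfield V e h) (lfield Z e) + conn e (lfield V e) (dlfield Z e h))) (at e)"
    by (rule has_derivative_transform_within_open[OF _ open_D e_in_D]) (simp add: conn_lfield)
  moreover have "((\<lambda>q. - (1 / 2) *\<^sub>R (flat_deriv V Z q + flat_deriv Z V q)) has_derivative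
     (\<lambda>h. - (1 / 2) *\<^sub>R ((ddlfield Z e h (lfield V e) + dlfield Z e (dlfield V e h)) +
        (ddlfield V e h (lfield Z e) + dlfield V e (dlfield Z e h))))) (at e)"
    by (intro has_derivative_scaleR_right has_derivative_add flat_deriv_has_derivative e_in_D)
  ultimately show ?thesis
    using has_derivative_unique by (fastforce simp: lfield_e dest: fun_cong[where x = h])
qed

lemma ddlfield_bracket:
  "ddlfield Z e h V + dlfield Z e (dlfield V e h) - (ddlfield V e h Z + dlfield V e (dlfield Z e h)) =
    dlfield (bracket V Z) e h"
proof -
  have "((\<lambda>q. flat_deriv V Z q - flat_deriv Z V q) has_derivative
     (\<lambda>h. (ddlfield Z e h (lfield V e) + dlfield Z e (dlfield V e h)) -
        (ddlfield V e h (lfield Z e) + dlfield V e (dlfield Z e h)))) (at e)"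
    by (intro has_derivative_diff flat_deriv_has_derivative e_in_D)
  then have "(lfield (bracket V Z) has_derivative
     (\<lambda>h. (ddlfield Z e h (lfield V e) + dlfield Z e (dlfield V e h)) -
        (ddlfield V e h (lfield Z e) + dlfield V e (dlfield Z e h)))) (at e)"
    by (rule has_derivative_transform_within_open[OF _ open_D e_in_D]) (simp add: bracket_field)
  from has_derivative_unique[OF this lfield_has_derivative[OF e_in_D]] show ?thesis
    by (simp add: lfield_e fun_eq_iff)
qed

text \<open>The left-hand side is \<open>R(U,Y)Y\<close> at the identity for constant coordinate fields. After inserting the
derivatives of the Christoffel symbol, the second derivatives of the fields cancel and, with
\<open>Z = [U,Y]\<close>, only \<open>-3/2 B Y Z - D Y(Z) - 1/2 D Z(Y)\<close> remains, which is \<open>1/4 [Y,Z]\<close> by the definition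
of \<open>B\<close>.\<close>

lemma curvature_conn:
  "dconn U Y Y + conn e U (conn e Y Y) - (dconn Y U Y + conn e Y (conn e U Y)) =
    (1 / 4) *\<^sub>R bracket Y (bracket U Y)"
proof -
  note bc = bilinear_conn[OF e_in_D]
  have bd: "linear (dlfield V e)" for V
    using bilinear_dlfield[OF e_in_D] by (simp add: bilinear_def)
  define Z where "Z = bracket U Y"
  define a where "a = dlfield Y e U"
  define b where "b = dlfield U e Y"
  define c where "c = dlfield Y e Y"
  have Z: "Z = a - b" by (simp add: Z_def a_def b_def bracket_def)
  have c0: "conn e V V' = - (1 / 2) *\<^sub>R (dlfield V' e V + dlfield V e V')" for V V'
    using conn_lfield[OF e_in_D, of V V'] by (simp add: lfield_e flat_deriv_e)
  have e1: "dconn U Y Y + conn e a Y + conn e Y a = - (ddlfield Y e U Y + dlfield Y e a)"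
    using dconn_lfields[of U Y Y] by (simp add: a_def flip: scaleR_left.add)
  have e2: "dconn Y U Y + conn e b Y + conn e U c =
      - (1 / 2) *\<^sub>R (ddlfield Y e Y U + dlfield Y e b + (ddlfield U e Y Y + dlfield U e c))"
    using dconn_lfields[of Y U Y] by (simp add: b_def c_def)
  have e3: "ddlfield U e Y Y + dlfield U e c =
     ddlfield Y e Y U + dlfield Y e b - dlfield Z e Y"
    using ddlfield_bracket[of Y Y U] by (simp add: b_def c_def Z_def algebra_simps)
  have e4: "ddlfield Y e Y U = ddlfield Y e U Y"
    by (rule ddlfield_symmetric[OF e_in_D])
  have e2': "dconn Y U Y + conn e b Y + conn e U c =
      - (ddlfield Y e U Y + dlfield Y e b) + (1 / 2) *\<^sub>R dlfield Z e Y"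
    unfolding e2 e3 e4 by (simp add: algebra_simps flip: scaleR_left.add)
  have cYY: "conn e Y Y = - c"
    using c0[of Y Y] by (simp add: c_def flip: scaleR_left.add)
  have cUY: "conn e U Y = (1 / 2) *\<^sub>R Z - a"
    using c0[of U Y] unfolding Z a_def[symmetric] b_def[symmetric]
    by (simp add: algebra_simps flip: scaleR_left.add)
  have d1: "dconn U Y Y = - (ddlfield Y e U Y + dlfield Y e a) - conn e a Y - conn e Y a"
    unfolding e1[symmetric] by simp
  have d2: "dconn Y U Y =
      - (ddlfield Y e U Y + dlfield Y e b) + (1 / 2) *\<^sub>R dlfield Z e Y - conn e b Y - conn e U c"
    unfolding e2'[symmetric] by simp
  have f1: "conn e U (conn e Y Y) = - conn e U c"
    by (simp add: cYY bilinear_rneg[OF bc])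
  have f2: "conn e Y (conn e U Y) = (1 / 2) *\<^sub>R conn e Y Z - conn e Y a"
    by (simp add: cUY bilinear_rsub[OF bc] bilinear_rmul[OF bc])
  have f3: "dlfield Y e a = dlfield Y e b + dlfield Y e Z"
    by (simp add: Z linear_diff[OF bd])
  have f4: "conn e a Y = conn e b Y + conn e Y Z"
    by (simp add: Z bilinear_rsub[OF bc] conn_sym[of e _ Y])
  have "dconn U Y Y + conn e U (conn e Y Y) - (dconn Y U Y + conn e Y (conn e U Y)) =
     - (3 / 2) *\<^sub>R conn e Y Z - dlfield Y e Z - (1 / 2) *\<^sub>R dlfield Z e Y"
    unfolding d1 d2 f1 f2 f3 f4
    by (rule euclidean_eqI) (simp add: inner_add_left inner_diff_left)
  also have "\<dots> = (1 / 4) *\<^sub>R (dlfield Z e Y - dlfield Y e Z)"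
    unfolding c0[of Y Z] by (simp add: algebra_simps flip: scaleR_left.add)
  also have "\<dots> = (1 / 4) *\<^sub>R bracket Y Z"
    by (simp add: bracket_def)
  finally show ?thesis by (simp add: Z_def)
qed

text \<open>For coefficients that do not depend on the direction \<open>z\<close>, the vertical terms of the horizontal
covariant derivative vanish, and the curvature on the slit tangent bundle is that of the base.\<close>

lemma hcurv_conn:
  assumes \<Gamma>: "\<And>x z. x \<in> D \<Longrightarrow> z \<noteq> 0 \<Longrightarrow> \<Gamma> x z = conn x" and Y: "Y \<noteq> 0"
  shows "hcurv \<Gamma> e Y U Y Y = (1 / 4) *\<^sub>R bracket Y (bracket U Y)"
proof -
  have one: "hcov \<Gamma> v (\<lambda>_ _. w) x z = conn x v w" if "x \<in> D" "z \<noteq> 0" for v w x z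
    using that by (simp add: hcov_def \<Gamma>)
  have two: "hcov \<Gamma> u (hcov \<Gamma> v (\<lambda>_ _. w)) e Y = dconn u v w + conn e u (conn e v w)" for u v w
  proof -
    have "((\<lambda>q. hcov \<Gamma> v (\<lambda>_ _. w) q Y) has_derivative (\<lambda>h. dconn h v w)) (at e)"
      by (rule has_derivative_transform_within_open[OF conn_has_derivative open_D e_in_D])
        (simp add: one Y)
    then have "frechet_derivative (\<lambda>q. hcov \<Gamma> v (\<lambda>_ _. w) q Y) (at e) = (\<lambda>h. dconn h v w)"
      by (rule frechet_derivative_at[symmetric])
    moreover have "((\<lambda>z. hcov \<Gamma> v (\<lambda>_ _. w) e z) has_derivative (\<lambda>_. 0)) (at Y)"
      by (rule has_derivative_transform_within_open[OF has_derivative_const, where s = "- {0}"])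
        (use Y e_in_D in \<open>auto simp: one\<close>)
    then have "frechet_derivative (\<lambda>z. hcov \<Gamma> v (\<lambda>_ _. w) e z) (at Y) = (\<lambda>_. 0)"
      by (rule frechet_derivative_at[symmetric])
    ultimately show ?thesis
      using Y e_in_D by (simp add: hcov_def[of \<Gamma> u] one \<Gamma>)
  qed
  show ?thesis
    unfolding hcurv_def two by (rule curvature_conn)
qed

end

section \<open>The fundamental tensor of a square metric\<close>

lemma DERIV_sqrt_quadratic:
  fixes a c d :: real
  assumes "a + 2 * x * c + x\<^sup>2 * d > 0"
  shows "((\<lambda>t. sqrt (a + 2 * t * c + t\<^sup>2 * d)) has_real_derivative
     (c + x * d) / sqrt (a + 2 * x * c + x\<^sup>2 * d)) (at x)"
  by (rule derivative_eq_intros refl | use assms in force)+ (use assms in \<open>simp add: field_simps\<close>)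

lemma DERIV_square_norm_profile:
  fixes r l :: "real \<Rightarrow> real"
  assumes "(r has_real_derivative r') (at t)" "(l has_real_derivative l') (at t)" "r t > 0"
  shows "((\<lambda>t. ((r t + l t)\<^sup>2 / r t)\<^sup>2) has_real_derivative
     4 * (r t + l t) ^ 3 * (r' + l') / (r t)\<^sup>2 - 2 * (r t + l t) ^ 4 * r' / (r t) ^ 3) (at t)"
  by (rule derivative_eq_intros assms refl | use assms in force)+
    (use assms in \<open>simp add: field_simps power2_eq_square power3_eq_cube power4_eq_xxxx\<close>)

text \<open>Along \<open>Y + s u + t v\<close> the squared metric is \<open>((r + l)\<^sup>2 / r)\<^sup>2\<close> with \<open>r\<close> the root of a quadratic
polynomial and \<open>l\<close> affine. At the unit vector \<open>Y\<close> the derivative of \<open>\<alpha>\<close> in the direction \<open>u\<close> is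
\<open>b Y u\<close>, and its second derivative is \<open>b u v - b Y u * b Y v\<close>.\<close>

lemma fundamental_tensor_square_metric:
  fixes b :: "'e::euclidean_space \<Rightarrow> 'e \<Rightarrow> real"
  assumes bil: "bilinear b" and sym: "\<And>u v. b u v = b v u" and Y: "b Y Y = 1"
    and k_def: "k = 1 + b X Y"
  shows "fundamental_tensor (\<lambda>y. (sqrt (b y y) + b X y)\<^sup>2 / sqrt (b y y)) Y u v =
     6 * k\<^sup>2 * (b Y u + b X u) * (b Y v + b X v) + 2 * k ^ 3 * (b u v - b Y u * b Y v)
     - 4 * k ^ 3 * ((b Y u + b X u) * b Y v + (b Y v + b X v) * b Y u)
     - k ^ 4 * (b u v - b Y u * b Y v) + 3 * k ^ 4 * b Y u * b Y v"
proof -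
  let ?N = "\<lambda>y. (sqrt (b y y) + b X y)\<^sup>2 / sqrt (b y y)"
  note b_simps = bilinear_ladd[OF bil] bilinear_radd[OF bil] bilinear_lmul[OF bil] bilinear_rmul[OF bil]
  define q where "q s = 1 + 2 * s * b Y u + s\<^sup>2 * b u u" for s
  define r where "r s = sqrt (q s)" for s
  define l where "l s = b X Y + s * b X u" for s
  define r' where "r' s = (b Y v + s * b u v) / r s" for s
  define H where "H s = 4 * (r s + l s) ^ 3 * (r' s + b X v) / (r s)\<^sup>2 - 2 * (r s + l s) ^ 4 * r' s / (r s) ^ 3" for s
  have inner: "deriv (\<lambda>t. (?N (Y + s *\<^sub>R u + t *\<^sub>R v))\<^sup>2) 0 = H s" if "q s > 0" for s
  proof (rule DERIV_imp_deriv)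
    have 1: "b (Y + s *\<^sub>R u + t *\<^sub>R v) (Y + s *\<^sub>R u + t *\<^sub>R v)
        = q s + 2 * t * (b Y v + s * b u v) + t\<^sup>2 * b v v" for t
      by (simp add: b_simps Y q_def sym[of u Y] sym[of v Y] sym[of v u] power2_eq_square algebra_simps)
    have 2: "b X (Y + s *\<^sub>R u + t *\<^sub>R v) = l s + t * b X v" for t
      by (simp add: b_simps l_def)
    have "((\<lambda>t. sqrt (q s + 2 * t * (b Y v + s * b u v) + t\<^sup>2 * b v v)) has_real_derivative r' s) (at 0)"
      using DERIV_sqrt_quadratic[of "q s" 0 "b Y v + s * b u v" "b v v"] that by (simp add: r'_def r_def)
    moreover have "((\<lambda>t. l s + t * b X v) has_real_derivative b X v) (at 0)"
      by (auto intro!: derivative_eq_intros)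
    ultimately show "((\<lambda>t. (?N (Y + s *\<^sub>R u + t *\<^sub>R v))\<^sup>2) has_real_derivative H s) (at 0)"
      unfolding 1 2 H_def
      using DERIV_square_norm_profile that by (fastforce simp: r_def)
  qed
  have "isCont q 0" unfolding q_def by (intro continuous_intros)
  then have "\<forall>\<^sub>F s in nhds 0. q s > 0"
    using order_tendstoD(1)[of q "q 0" "nhds 0" 0] by (simp add: q_def isCont_def tendsto_nhds_iff)
  then have ev: "\<forall>\<^sub>F s in nhds 0. deriv (\<lambda>t. (?N (Y + s *\<^sub>R u + t *\<^sub>R v))\<^sup>2) 0 = H s"
    by eventually_elim (rule inner)
  have r0: "r 0 = 1" "l 0 = b X Y" "r' 0 = b Y v" by (simp_all add: r_def q_def l_def r'_def)
  have dr: "(r has_real_derivative b Y u) (at 0)"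
    using DERIV_sqrt_quadratic[of 1 0 "b Y u" "b u u"] by (simp add: r_def[abs_def] q_def)
  have dl: "(l has_real_derivative b X u) (at 0)"
    unfolding l_def by (auto intro!: derivative_eq_intros)
  have dr': "(r' has_real_derivative b u v - b Y v * b Y u) (at 0)"
    unfolding r'_def by (rule derivative_eq_intros dr refl | simp add: r0)+
  have "(H has_real_derivative
     2 * (6 * k\<^sup>2 * (b Y u + b X u) * (b Y v + b X v) + 2 * k ^ 3 * (b u v - b Y u * b Y v)
     - 4 * k ^ 3 * ((b Y u + b X u) * b Y v + (b Y v + b X v) * b Y u)
     - k ^ 4 * (b u v - b Y u * b Y v) + 3 * k ^ 4 * b Y u * b Y v)) (at 0)"
    unfolding H_def
    by (rule derivative_eq_intros dr dl dr' refl | simp add: r0)+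
      (simp add: r0 k_def algebra_simps power2_eq_square power3_eq_cube power4_eq_xxxx)
  then show ?thesis
    unfolding fundamental_tensor_def deriv_cong_ev[OF ev refl] by (simp add: DERIV_imp_deriv)
qed

lemma flag_quotient:
  fixes b :: "'e::euclidean_space \<Rightarrow> 'e \<Rightarrow> real" and X Y U R :: 'e
  assumes bil: "bilinear b" and sym: "\<And>u v. b u v = b v u"
    and Y: "b Y Y = 1" and U: "b U U = 1" and YU: "b Y U = 0" and YR: "b Y R = 0"
  defines "gY \<equiv> fundamental_tensor (\<lambda>y. (sqrt (b y y) + b X y)\<^sup>2 / sqrt (b y y)) Y"
  shows "gY R U / (gY Y Y * gY U U - (gY Y U)\<^sup>2) =
    (6 * b X R * b X U + b U R * (1 - (b X Y)\<^sup>2)) /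
    ((1 + b X Y) ^ 4 * (2 * (b X U)\<^sup>2 - (b X Y)\<^sup>2 + 1))"
proof -
  define k where "k = 1 + b X Y"
  note gY = fundamental_tensor_square_metric[OF bil sym Y k_def, folded gY_def]
  have 1: "gY R U = k\<^sup>2 * (6 * b X R * b X U + b U R * (1 - (b X Y)\<^sup>2))"
    unfolding gY YU YR sym[of R U] k_def by algebra
  have 2: "gY Y Y * gY U U - (gY Y U)\<^sup>2 = k\<^sup>2 * (k ^ 4 * (2 * (b X U)\<^sup>2 - (b X Y)\<^sup>2 + 1))"
    unfolding gY YU Y U k_def by algebra
  show ?thesis
    \<comment> \<open>for \<open>k = 0\<close> both denominators are zero, so both quotients are zero by convention\<close>
    unfolding 1 2 k_def[symmetric] by (cases "k = 0") (simp, rule mult_divide_mult_cancel_left, simp)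
qed

section \<open>Charts and tangent vectors\<close>

lemma
  assumes "smooth_atlas A"
  shows chart_at_in_atlas: "chart_at A x \<in> A" and chart_at_contains: "x \<in> fst (chart_at A x)"
proof -
  have "\<exists>c. c \<in> A \<and> x \<in> fst c" using assms unfolding smooth_atlas_def by blast
  from someI_ex[OF this] show "chart_at A x \<in> A" "x \<in> fst (chart_at A x)"
    unfolding chart_at_def by auto
qed

context
  fixes A :: "('g::{t2_space, second_countable_topology}, 'e::euclidean_space) chart set" and c
  assumes atlas: "smooth_atlas A" and c: "c \<in> A"
begin

lemma chart_homeomorphism: "homeomorphism (fst c) (chart_image c) (snd c) (chart_inv c)"
  and open_chart_image: "open (chart_image c)" and open_chart_domain: "open (fst c)"
  using atlas c unfolding smooth_atlas_def by blast+

lemma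
  shows chart_inv_coord: "a \<in> fst c \<Longrightarrow> chart_inv c (snd c a) = a"
    and coord_chart_inv: "p \<in> chart_image c \<Longrightarrow> snd c (chart_inv c p) = p"
    and chart_inv_mem: "p \<in> chart_image c \<Longrightarrow> chart_inv c p \<in> fst c"
    and coord_mem: "a \<in> fst c \<Longrightarrow> snd c a \<in> chart_image c"
  using chart_homeomorphism by (auto simp: homeomorphism_def)

lemma continuous_on_chart_inv: "continuous_on (chart_image c) (chart_inv c)"
  using chart_homeomorphism by (simp add: homeomorphism_def)

lemma chart_overlap_eq: "snd c ` (fst c \<inter> S) = {p \<in> chart_image c. chart_inv c p \<in> S}"
proof (intro equalityI subsetI)
  fix p assume "p \<in> {p \<in> chart_image c. chart_inv c p \<in> S}"
  then show "p \<in> snd c ` (fst c \<inter> S)"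
    by (intro image_eqI[of _ _ "chart_inv c p"]) (auto simp: coord_chart_inv chart_inv_mem)
qed (auto simp: chart_inv_coord coord_mem)

lemma open_chart_overlap:
  assumes "open S"
  shows "open {p \<in> chart_image c. chart_inv c p \<in> S}"
  using continuous_open_preimage[OF continuous_on_chart_inv open_chart_image assms]
  by (simp add: vimage_def Int_def)

end

lemma transition_has_derivative:
  assumes atlas: "smooth_atlas A" and c: "c \<in> A" and d: "d \<in> A"
    and p: "p \<in> chart_image c" "chart_inv c p \<in> fst d"
  shows "((snd d \<circ> chart_inv c) has_derivative frechet_derivative (snd d \<circ> chart_inv c) (at p)) (at p)"
proof -
  have "smooth_on (snd d \<circ> chart_inv c) (snd c ` (fst c \<inter> fst d))"
    using atlas c d unfolding smooth_atlas_def by blast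
  then show ?thesis
    by (rule smooth_on_has_derivative) (use p in \<open>simp add: chart_overlap_eq[OF atlas c]\<close>)
qed

lemma from_chart_has_derivative:
  assumes "smooth_atlas A" "c \<in> A" "p \<in> chart_image c"
  shows "((snd (chart_at A (chart_inv c p)) \<circ> chart_inv c) has_derivative from_chart A c p) (at p)"
  using transition_has_derivative[OF assms(1,2) chart_at_in_atlas[OF assms(1)] assms(3) chart_at_contains[OF assms(1)]]
  by (simp add: from_chart_def[abs_def])

lemma linear_from_chart:
  assumes "smooth_atlas A" "c \<in> A" "p \<in> chart_image c"
  shows "linear (from_chart A c p)"
  using from_chart_has_derivative[OF assms] by (rule has_derivative_linear)

text \<open>The two coordinate changes between \<open>c\<close> and the preferred chart at the point are inverse to each
other, hence so are their derivatives.\<close>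

lemma to_chart_from_chart:
  assumes atlas: "smooth_atlas A" and c: "c \<in> A" and p: "p \<in> chart_image c"
  shows "to_chart A c (chart_inv c p) (from_chart A c p y) = y"
proof -
  define a where "a = chart_inv c p"
  define d where "d = chart_at A a"
  have d: "d \<in> A" "a \<in> fst d" using chart_at_in_atlas[OF atlas] chart_at_contains[OF atlas] by (auto simp: d_def)
  have a: "a \<in> fst c" using chart_inv_mem[OF atlas c p] by (simp add: a_def)
  have qa: "chart_inv d (snd d a) = a" by (rule chart_inv_coord[OF atlas d])
  have "((snd c \<circ> chart_inv d) has_derivative to_chart A c a) (at (snd d a))"
    using transition_has_derivative[OF atlas d(1) c coord_mem[OF atlas d]] a qa
    by (simp add: to_chart_def[abs_def] coord_at_def d_def)
  then have 1: "((snd c \<circ> chart_inv d) has_derivative to_chart A c a) (at ((snd d \<circ> chart_inv c) p))"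
    by (simp add: a_def)
  have 2: "((snd d \<circ> chart_inv c) has_derivative from_chart A c p) (at p)"
    using from_chart_has_derivative[OF atlas c p] by (simp add: d_def a_def)
  have "((\<lambda>q. q) has_derivative (to_chart A c a \<circ> from_chart A c p)) (at p)"
  proof (rule has_derivative_transform_within_open[OF diff_chain_at[OF 2 1]])
    show "open {q \<in> chart_image c. chart_inv c q \<in> fst d}"
      by (rule open_chart_overlap[OF atlas c open_chart_domain[OF atlas d(1)]])
  qed (use p d in \<open>auto simp: a_def[symmetric] chart_inv_coord[OF atlas d(1)] coord_chart_inv[OF atlas c]\<close>)
  from fun_cong[OF has_derivative_unique[OF this has_derivative_ident], of y]
  show ?thesis by (simp add: a_def)
qed

section \<open>A Lie group near its identity\<close>

text \<open>The passage from the group to \<open>local_lie_group\<close>, in the preferred chart at the identity. This chart is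
the one used by the flag curvature at the identity, and in it tangent vectors at the identity are their
own components.\<close>

locale lie_group_chart =
  fixes A :: "('g::{t2_space, second_countable_topology}, 'e::euclidean_space) chart set"
    and G :: "('g, 'm) monoid_scheme" (structure)
  assumes lie: "lie_group A G"
begin

sublocale group G
  using lie by (simp add: lie_group_def)

lemma atlas: "smooth_atlas A" and carrier: "carrier G = UNIV"
  and smooth_mult: "smooth_map (prod_atlas A A) A (\<lambda>(a, b). a \<otimes> b)"
  using lie by (auto simp: lie_group_def)

definition c :: "('g, 'e) chart" where "c = chart_at A \<one>"
definition D :: "'e set" where "D = chart_image c"
text \<open>The product chart is kept as a chart of \<open>G \<times> G\<close> so that smoothness of \<open>mu\<close> on \<open>W\<close> is literally an
instance of smoothness of the multiplication.\<close>

definition cc :: "('g \<times> 'g, 'e \<times> 'e) chart" where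
  "cc = (fst c \<times> fst c, map_prod (snd c) (snd c))"
definition W :: "('e \<times> 'e) set" where
  "W = snd cc ` (fst cc \<inter> (\<lambda>(a, b). a \<otimes> b) -` fst c)"
definition mu :: "'e \<times> 'e \<Rightarrow> 'e" where
  "mu = snd c \<circ> (\<lambda>(a, b). a \<otimes> b) \<circ> chart_inv cc"
definition e0 :: 'e where "e0 = snd c \<one>"

lemma c: "c \<in> A" and one_in_c: "\<one> \<in> fst c"
  using chart_at_in_atlas[OF atlas] chart_at_contains[OF atlas] by (auto simp: c_def)

lemmas chart_inv_coord_c = chart_inv_coord[OF atlas c]
  and coord_chart_inv_c = coord_chart_inv[OF atlas c, folded D_def]
  and chart_inv_mem_c = chart_inv_mem[OF atlas c, folded D_def]
  and coord_mem_c = coord_mem[OF atlas c, folded D_def]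

lemma chart_inv_cc:
  assumes "x \<in> D" "y \<in> D"
  shows "chart_inv cc (x, y) = (chart_inv c x, chart_inv c y)"
proof -
  have inv: "chart_inv cc = inv_into (fst c \<times> fst c) (map_prod (snd c) (snd c))"
    by (simp add: chart_inv_def cc_def)
  have "inj_on (snd c) (fst c)" by (rule inj_on_inverseI) (rule chart_inv_coord_c)
  from inv_into_f_f[OF map_prod_inj_on[OF this this], of "(chart_inv c x, chart_inv c y)"] show ?thesis
    using assms by (simp add: inv chart_inv_mem_c coord_chart_inv_c)
qed

lemma mu_eq: "x \<in> D \<Longrightarrow> y \<in> D \<Longrightarrow> mu (x, y) = snd c (chart_inv c x \<otimes> chart_inv c y)"
  by (simp add: mu_def chart_inv_cc)

lemma W_eq: "W = {(x, y). x \<in> D \<and> y \<in> D \<and> chart_inv c x \<otimes> chart_inv c y \<in> fst c}"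
proof (intro equalityI subsetI)
  fix z assume "z \<in> W"
  then show "z \<in> {(x, y). x \<in> D \<and> y \<in> D \<and> chart_inv c x \<otimes> chart_inv c y \<in> fst c}"
    by (auto simp: W_def cc_def chart_inv_coord_c coord_mem_c)
next
  fix z assume "z \<in> {(x, y). x \<in> D \<and> y \<in> D \<and> chart_inv c x \<otimes> chart_inv c y \<in> fst c}"
  then obtain x y where z: "z = (x, y)" "x \<in> D" "y \<in> D" "chart_inv c x \<otimes> chart_inv c y \<in> fst c" by auto
  show "z \<in> W"
    unfolding W_def
    by (rule image_eqI[of _ _ "(chart_inv c x, chart_inv c y)"])
      (use z in \<open>auto simp: cc_def coord_chart_inv_c chart_inv_mem_c\<close>)
qed

lemma open_chart_domain_D: "open D"
  unfolding D_def by (rule open_chart_image[OF atlas c])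

lemma open_mult_domain: "open W"
proof -
  have cont: "continuous_on UNIV (\<lambda>(a, b). a \<otimes> b)"
    using smooth_mult by (simp add: smooth_map_def)
  have ci: "continuous_on D (chart_inv c)"
    unfolding D_def by (rule continuous_on_chart_inv[OF atlas c])
  have "continuous_on (D \<times> D) (\<lambda>z. (chart_inv c (fst z), chart_inv c (snd z)))"
    by (intro continuous_on_Pair continuous_on_compose2[OF ci] continuous_on_fst continuous_on_snd continuous_on_id) auto
  from continuous_on_compose2[OF cont this]
  have "continuous_on (D \<times> D) (\<lambda>z. chart_inv c (fst z) \<otimes> chart_inv c (snd z))" by simp
  from continuous_open_preimage[OF this open_Times[OF open_chart_domain_D open_chart_domain_D] open_chart_domain[OF atlas c]]
  show ?thesis
    unfolding W_eq by (rule back_subst[where P = "open"]) auto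
qed

lemma smooth_chart_mult: "smooth_on mu W"
proof -
  have "cc \<in> prod_atlas A A" unfolding prod_atlas_def
    by (rule CollectI, intro exI[of _ c]) (simp add: cc_def c)
  then show ?thesis
    using smooth_mult c unfolding smooth_map_def mu_def W_def by blast
qed

sublocale local_lie_group mu W D e0
proof
  show "open D" by (rule open_chart_domain_D)
  show "open W" by (rule open_mult_domain)
  show "smooth_on mu W" by (rule smooth_chart_mult)
  show e: "e0 \<in> D" using coord_mem_c one_in_c by (simp add: e0_def)
  have inv_e: "chart_inv c e0 = \<one>" by (simp add: e0_def chart_inv_coord_c one_in_c)
  show "x \<in> D \<and> y \<in> D \<and> mu (x, y) \<in> D" if "(x, y) \<in> W" for x y
    using that by (auto simp: W_eq mu_eq coord_mem_c)
  show "(x, e0) \<in> W \<and> mu (x, e0) = x" if "x \<in> D" for x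
    using that e by (simp add: W_eq mu_eq inv_e carrier chart_inv_mem_c coord_chart_inv_c)
  show "(e0, x) \<in> W \<and> mu (e0, x) = x" if "x \<in> D" for x
    using that e by (simp add: W_eq mu_eq inv_e carrier chart_inv_mem_c coord_chart_inv_c)
  show "mu (x, mu (y, z)) = mu (mu (x, y), z)"
    if "(x, y) \<in> W" "(y, z) \<in> W" "(x, mu (y, z)) \<in> W" "(mu (x, y), z) \<in> W" for x y z
    using that by (auto simp: W_eq mu_eq coord_mem_c chart_inv_coord_c carrier m_assoc)
qed

lemma chart_inv_e0: "chart_inv c e0 = \<one>"
  by (simp add: e0_def chart_inv_coord_c one_in_c)

lemma coord_at_one: "coord_at A \<one> = e0"
  by (simp add: coord_at_def c_def e0_def)

text \<open>The chain rule: the tangent map of \<open>f\<close> at the identity, defined with the preferred chart at the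
value of \<open>f\<close>, is computed by the representation \<open>h\<close> of \<open>f\<close> in the single chart \<open>c\<close>. For translations
it identifies \<open>lfield\<close> and \<open>rfield\<close> with the invariant fields of the group.\<close>

lemma from_chart_derivative:
  assumes N: "open N" "e0 \<in> N" "N \<subseteq> D"
    and h: "(h has_derivative h') (at e0)" and p: "p \<in> D" and f1: "f \<one> = chart_inv c p"
    and hf: "\<And>y. y \<in> N \<Longrightarrow> f (chart_inv c y) \<in> fst c \<and> h y = snd c (f (chart_inv c y))"
  shows "from_chart A c p (h' V) = tangent_map A A f \<one> V"
proof -
  let ?d = "chart_at A (chart_inv c p)"
  have he: "h e0 = p" using hf[OF N(2)] p by (simp add: chart_inv_e0 f1 coord_chart_inv_c)
  have "((snd ?d \<circ> chart_inv c) has_derivative from_chart A c p) (at (h e0))"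
    unfolding he using from_chart_has_derivative[OF atlas c] p by (simp add: D_def)
  from diff_chain_at[OF h this]
  have "((snd ?d \<circ> f \<circ> chart_inv c) has_derivative (from_chart A c p \<circ> h')) (at e0)"
    by (rule has_derivative_transform_within_open[OF _ N(1,2)]) (use hf in \<open>auto simp: chart_inv_coord_c\<close>)
  from frechet_derivative_at[OF this] show ?thesis
    by (simp add: tangent_map_def f1 coord_at_one c_def[symmetric] fun_eq_iff)
qed

lemma from_chart_lfield:
  assumes p: "p \<in> D"
  shows "from_chart A c p (lfield V p) = tangent_map A A (\<lambda>b. chart_inv c p \<otimes> b) \<one> V"
proof (rule from_chart_derivative[where N = "{y. (p, y) \<in> W}" and h = "\<lambda>y. mu (p, y)"
      and h' = "\<lambda>V. lfield V p"])
  show "open {y. (p, y) \<in> W}"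
    using open_vimage[OF open_W continuous_on_Pair[OF continuous_on_const continuous_on_id], of p]
    by (simp add: vimage_def)
  show "((\<lambda>y. mu (p, y)) has_derivative (\<lambda>V. lfield V p)) (at e0)"
    unfolding lfield_def by (rule smooth_on_has_derivative_snd[OF smooth_mu]) (use right_unit p in simp)
qed (use p right_unit in \<open>auto simp: W_eq mu_eq carrier\<close>)

lemma from_chart_rfield:
  assumes p: "p \<in> D"
  shows "from_chart A c p (rfield V p) = tangent_map A A (\<lambda>b. b \<otimes> chart_inv c p) \<one> V"
proof (rule from_chart_derivative[where N = "{y. (y, p) \<in> W}" and h = "\<lambda>y. mu (y, p)"
      and h' = "\<lambda>V. rfield V p"])
  show "open {y. (y, p) \<in> W}"
    using open_vimage[OF open_W continuous_on_Pair[OF continuous_on_id continuous_on_const], of p]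
    by (simp add: vimage_def)
  show "((\<lambda>y. mu (y, p)) has_derivative (\<lambda>V. rfield V p)) (at e0)"
    unfolding rfield_def by (rule smooth_on_has_derivative_fst[OF smooth_mu]) (use left_unit p in simp)
qed (use p left_unit in \<open>auto simp: W_eq mu_eq carrier\<close>)

text \<open>Hence the bracket computed in the chart is the bracket of the Lie algebra.\<close>

lemma field_in_chart_left_extension:
  assumes p: "p \<in> D"
  shows "field_in_chart A c (left_extension A G V) p = lfield V p"
  using to_chart_from_chart[OF atlas c, of p "lfield V p"] p
  by (simp add: field_in_chart_def left_extension_def from_chart_lfield D_def)

lemma lie_algebra_bracket_eq: "lie_algebra_bracket A G U V = bracket U V"
proof -
  have "frechet_derivative (field_in_chart A c (left_extension A G V)) (at e0) = dlfield V e0" for V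
    by (rule frechet_derivative_at[symmetric], rule has_derivative_transform_within_open[OF
          lfield_has_derivative[OF e_in_D] open_D e_in_D]) (simp add: field_in_chart_left_extension)
  then show ?thesis
    by (simp add: lie_algebra_bracket_def lie_bracket_def Let_def c_def[symmetric] coord_at_one bracket_def
        field_in_chart_left_extension e_in_D lfield_e)
qed

lemma from_chart_e0: "from_chart A c e0 v = v"
proof -
  have "((\<lambda>y. y) has_derivative from_chart A c e0) (at e0)"
    by (rule has_derivative_transform_within_open[OF from_chart_has_derivative[OF atlas c] open_D e_in_D])
      (use e_in_D in \<open>auto simp: D_def[symmetric] chart_inv_e0 c_def[symmetric] coord_chart_inv_c\<close>)
  from fun_cong[OF has_derivative_unique[OF this has_derivative_ident]] show ?thesis .
qed

end

text \<open>In the chart, left and right invariance of \<open>g\<close> become constancy of the inner products of left and of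
right invariant fields.\<close>

locale bi_invariant_lie_group_chart = lie_group_chart A G
  for A :: "('g::{t2_space, second_countable_topology}, 'e::euclidean_space) chart set"
    and G :: "('g, 'm) monoid_scheme" (structure) +
  fixes g :: "'g \<Rightarrow> 'e \<Rightarrow> 'e \<Rightarrow> real"
  assumes bi: "bi_invariant_metric A G g"
begin

lemma metric_e0: "metric_in_chart A c g e0 = g \<one>"
  by (simp add: metric_in_chart_def fun_eq_iff chart_inv_e0 from_chart_e0)

lemma riemannian: "riemannian_metric A g"
  and left_invariance: "g (a \<otimes> x) (tangent_map A A (\<lambda>b. a \<otimes> b) x u) (tangent_map A A (\<lambda>b. a \<otimes> b) x v) = g x u v"
  and right_invariance: "g (x \<otimes> a) (tangent_map A A (\<lambda>b. b \<otimes> a) x u) (tangent_map A A (\<lambda>b. b \<otimes> a) x v) = g x u v"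
  using bi by (auto simp: bi_invariant_metric_def)

lemma bilinear_g: "bilinear (g x)" and g_sym: "g x u v = g x v u" and g_pos: "u \<noteq> 0 \<Longrightarrow> g x u u > 0"
  using riemannian by (auto simp: riemannian_metric_def)

sublocale bi_invariant_local_lie_group mu W D e0 "metric_in_chart A c g"
proof
  fix x assume x: "x \<in> D"
  note lin = linear_from_chart[OF atlas c x[unfolded D_def]]
  show "bilinear (metric_in_chart A c g x)"
    unfolding bilinear_def linear_iff metric_in_chart_def
    by (simp add: linear_add[OF lin] linear_scale[OF lin] bilinear_ladd[OF bilinear_g]
        bilinear_radd[OF bilinear_g] bilinear_lmul[OF bilinear_g] bilinear_rmul[OF bilinear_g])
  show "metric_in_chart A c g x u v = metric_in_chart A c g x v u" for u v
    unfolding metric_in_chart_def by (rule g_sym)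
  show "(\<lambda>q. metric_in_chart A c g q u v) differentiable at x" for u v
    by (rule smooth_on_differentiable[of _ "chart_image c"])
      (use riemannian c x in \<open>auto simp: riemannian_metric_def D_def\<close>)
  show "metric_in_chart A c g x (lfield V x) (lfield Z x) = metric_in_chart A c g e0 V Z" for V Z
    using left_invariance[of "chart_inv c x" \<one> V Z]
    by (simp add: metric_e0) (simp add: metric_in_chart_def from_chart_lfield x carrier)
  show "metric_in_chart A c g x (rfield V x) (rfield Z x) = metric_in_chart A c g e0 V Z" for V Z
    using right_invariance[of \<one> "chart_inv c x" V Z]
    by (simp add: metric_e0) (simp add: metric_in_chart_def from_chart_rfield x carrier)
next
  show "metric_in_chart A c g e0 u u > 0" if "u \<noteq> 0" for u
    using that by (simp add: metric_e0 g_pos)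
qed

lemma levi_civita_eq: "x \<in> D \<Longrightarrow> levi_civita A g c x = conn x"
  unfolding levi_civita_def by (rule levi_civita_conn)

end

section \<open>Flag curvature\<close>

theorem corollary3p4:
  fixes G :: "('g::{t2_space, second_countable_topology}, 'm) monoid_scheme"
    and A :: "('g, 'e::euclidean_space) chart set"
    and g :: "'g \<Rightarrow> 'e \<Rightarrow> 'e \<Rightarrow> real"
    and Xt :: "'g \<Rightarrow> 'e"
    and \<alpha> \<beta> F :: "'g \<Rightarrow> 'e \<Rightarrow> real"
    and X Y U :: 'e
    and ip :: "'e \<Rightarrow> 'e \<Rightarrow> real" (\<open>\<langle>_, _\<rangle>\<close>)
    and br :: "'e \<Rightarrow> 'e \<Rightarrow> 'e"
  assumes "lie_group A G"
    and "bi_invariant_metric A G g"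
    and "left_invariant_field A G Xt"
    and "\<forall>x. g x (Xt x) (Xt x) < 1"
    and "\<alpha> = (\<lambda>x y. sqrt (g x y y))"
    and "\<beta> = (\<lambda>x y. g x (Xt x) y)"
    and "F = (\<lambda>x y. (\<alpha> x y + \<beta> x y)\<^sup>2 / \<alpha> x y)"
    and "chern_coincides_with_levi_civita A F g"
    and "ip = g \<one>\<^bsub>G\<^esub>" and "br = lie_algebra_bracket A G" and "X = Xt \<one>\<^bsub>G\<^esub>"
    and "\<langle>Y, Y\<rangle> = 1" and "\<langle>U, U\<rangle> = 1" and "\<langle>Y, U\<rangle> = 0"
  shows "flag_curvature A F \<one>\<^bsub>G\<^esub> Y U =
    (6 * \<langle>X, br Y (br U Y)\<rangle> * \<langle>X, U\<rangle> + \<langle>U, br Y (br U Y)\<rangle> * (1 - \<langle>X, Y\<rangle>\<^sup>2)) /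
    (4 * (1 + \<langle>X, Y\<rangle>) ^ 4 * (2 * \<langle>X, U\<rangle>\<^sup>2 - \<langle>X, Y\<rangle>\<^sup>2 + 1))"
proof -
  interpret bi_invariant_lie_group_chart A G g
    using assms(1,2) by unfold_locales
  have bil: "bilinear ip" and sym: "ip u v = ip v u" for u v
    using bilinear_g g_sym assms(9) by auto
  have br: "br = bracket" using assms(10) by (simp add: fun_eq_iff lie_algebra_bracket_eq)
  define R where "R = (1 / 4) *\<^sub>R br Y (br U Y)"
  have "Y \<noteq> 0" using assms(12) bilinear_lzero[OF bil] by auto
  moreover have "chern A F c x z = conn x" if "x \<in> D" "z \<noteq> 0" for x z
    using assms(8) c that by (simp add: chern_coincides_with_levi_civita_def D_def levi_civita_eq)
  ultimately have R: "hcurv (chern A F (chart_at A \<one>\<^bsub>G\<^esub>)) (coord_at A \<one>\<^bsub>G\<^esub>) Y U Y Y = R"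
    unfolding R_def br coord_at_one c_def[symmetric] by (intro hcurv_conn)
  have "bracket Y Y = 0" by (simp add: bracket_def)
  then have "ip Y R = 0"
    using ad_invariance[of Y Y "bracket U Y"] bilinear_lzero[OF bil]
    by (simp add: R_def br metric_e0 assms(9)[symmetric] bilinear_rmul[OF bil])
  note quot = flag_quotient[OF bil sym assms(12-14) this, of X]
  have F1: "F \<one>\<^bsub>G\<^esub> = (\<lambda>y. (sqrt (ip y y) + ip X y)\<^sup>2 / sqrt (ip y y))"
    using assms(5-7,9,11) by simp
  have "flag_curvature A F \<one>\<^bsub>G\<^esub> Y U =
    (6 * ip X R * ip X U + ip U R * (1 - (ip X Y)\<^sup>2)) /
    ((1 + ip X Y) ^ 4 * (2 * (ip X U)\<^sup>2 - (ip X Y)\<^sup>2 + 1))"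
    unfolding flag_curvature_def Let_def R F1 by (rule quot)
  also have "6 * ip X R * ip X U + ip U R * (1 - (ip X Y)\<^sup>2) =
     (6 * ip X (br Y (br U Y)) * ip X U + ip U (br Y (br U Y)) * (1 - (ip X Y)\<^sup>2)) / 4"
    by (simp add: R_def bilinear_rmul[OF bil] field_simps)
  finally show ?thesis by (simp add: mult.assoc)
qed

end
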